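(* Let $E$ be a field. Then the following conditions are equivalent: (1) $E$ has only finitely many maximal subrings. (2) $E$ is an absolutely algebraic field and $[E:L(E)]$ is finite. (3) $E$ has a subfield $F$ which has no maximal subrings and such that $[E:F]$ is finite. In particular, if one of these conditions holds, then the subfield $F$ in (3) is $F=L(E)$.
   Context: All rings are commutative with $1\neq 0$ and subrings are unital. A proper subring $S$ of a ring $R$ is a maximal subring of $R$ if it is maximal with respect to inclusion among all proper subrings of $R$ (a subring of a field need not be a field). An absolutely algebraic field is a field that is algebraic over $\mathbb{F}_p$ for some prime $p$; regard it as a subfield of a fixed algebraic closure $\bar{\mathbb{F}}_p$. For an absolutely algebraic field $E$ of characteristic $p$ put $FG(E)=\{n\in\mathbb{N} : \mathbb{F}_{p^n}\subseteq E\}$ (with $\mathbb N$ the positive integers), and for $T=FG(E)$ let $T_\infty$ be the set of primes $q$ such that $q^n\in T$ for all $n\in\mathbb{N}$. Then $L(E)$ denotes the subfield $\bigcup_{n\in T'}\mathbb{F}_{p^n}$ of $E$, where $T'$ is the set of all positive integers all of whose prime divisors lie in $T_\infty$ (so $1\in T'$). *)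

theory Defs
  imports "HOL-Algebra.Algebra" "HOL-Computational_Algebra.Primes"
begin

text \<open>Subrings are unital: the library's \<open>subring\<close> requires that they contain \<open>\<one>\<close>.\<close>

definition maximal_subring :: "'a set \<Rightarrow> ('a, 'b) ring_scheme \<Rightarrow> bool" where
  "maximal_subring S R \<longleftrightarrow> subring S R \<and> S \<noteq> carrier R \<and>
     (\<forall>T. subring T R \<longrightarrow> S \<subseteq> T \<longrightarrow> T = S \<or> T = carrier R)"

text \<open>The additive order of \<open>\<one>\<close>; \<^term>\<open>group.ord\<close> is \<open>0\<close> on elements of infinite order.\<close>

definition ring_char :: "('a, 'b) ring_scheme \<Rightarrow> nat" where
  "ring_char R = group.ord (add_monoid R) \<one>\<^bsub>R\<^esub>"

text \<open>
  \<open>GF_sub E p n K\<close> says that \<open>K\<close> is the copy of the field with \<open>p\<^sup>n\<close> elements inside \<open>E\<close>. Once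
  \<open>E\<close> is embedded in an algebraic closure, a subfield of \<open>E\<close> with \<open>p\<^sup>n\<close> elements is the
  \<open>p\<^sup>n\<close>-element subfield of that closure, and there is only one (\<open>GF_sub_unique\<close>). So the inclusion
  of the latter in \<open>E\<close> is expressed without reference to the closure as \<open>\<exists>K. GF_sub E p n K\<close>.
\<close>

definition GF_sub :: "('a, 'b) ring_scheme \<Rightarrow> nat \<Rightarrow> nat \<Rightarrow> 'a set \<Rightarrow> bool" where
  "GF_sub E p n K \<longleftrightarrow> subfield K E \<and> finite K \<and> card K = p ^ n"

definition absolutely_algebraic :: "('a, 'b) ring_scheme \<Rightarrow> bool" where
  "absolutely_algebraic E \<longleftrightarrow> field E \<and>
     (\<exists>p K. Factorial_Ring.prime p \<and> GF_sub E p 1 K \<and> (\<forall>x\<in>carrier E. (ring.algebraic E over K) x))"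

definition FG :: "('a, 'b) ring_scheme \<Rightarrow> nat set" where
  "FG E = {n. 0 < n \<and> (\<exists>K. GF_sub E (ring_char E) n K)}"

definition T_infty :: "nat set \<Rightarrow> nat set" where
  "T_infty T = {q. Factorial_Ring.prime q \<and> (\<forall>n>0. q ^ n \<in> T)}"

definition T_prime :: "nat set \<Rightarrow> nat set" where
  "T_prime T = {n. 0 < n \<and> (\<forall>q. Factorial_Ring.prime q \<longrightarrow> q dvd n \<longrightarrow> q \<in> T_infty T)}"

definition L_sub :: "('a, 'b) ring_scheme \<Rightarrow> 'a set" where
  "L_sub E = \<Union> {K. \<exists>n \<in> T_prime (FG E). GF_sub E (ring_char E) n K}"

lemma (in field) card_roots_of_unity_le:
  assumes "0 < d"
  shows "finite {x \<in> carrier R. x [^] d = \<one>}" "card {x \<in> carrier R. x [^] d = \<one>} \<le> d"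
proof -
  define p where "p = \<one> # replicate (d - 1) \<zero> @ [\<ominus> \<one>]"
  have p: "p \<in> carrier (poly_ring R)"
    unfolding p_def sym[OF univ_poly_carrier] polynomial_def by auto
  have len: "length p = Suc d"
    using assms by (simp add: p_def)
  have ev: "eval p x = x [^] d \<ominus> \<one>" if x: "x \<in> carrier R" for x
  proof -
    have "eval (replicate k \<zero> @ [\<ominus> \<one>]) x = \<ominus> \<one>" for k
      using x by (induction k) auto
    then show ?thesis
      using x assms by (simp add: p_def a_minus_def)
  qed
  have sub: "{x \<in> carrier R. x [^] d = \<one>} \<subseteq> set_mset (roots p)"
  proof
    fix x assume x: "x \<in> {x \<in> carrier R. x [^] d = \<one>}"
    then have "eval p x = \<zero>" by (simp add: ev)
    moreover have "p \<noteq> []" using len by auto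
    ultimately have "is_root p x" using x by (simp add: is_root_def)
    then show "x \<in> set_mset (roots p)" using roots_mem_iff_is_root[OF p] by simp
  qed
  then show "finite {x \<in> carrier R. x [^] d = \<one>}"
    by (rule finite_subset) simp
  have "card {x \<in> carrier R. x [^] d = \<one>} \<le> card (set_mset (roots p))"
    using sub by (intro card_mono) auto
  also have "\<dots> \<le> size (roots p)"
    by (metis mset_set_set_mset_msubset size_mset_mono size_mset_set)
  also have "\<dots> \<le> d"
    using size_roots_le_degree[OF p] len by simp
  finally show "card {x \<in> carrier R. x [^] d = \<one>} \<le> d" .
qed

lemma (in field) finite_subfield_minus_zero:
  assumes K: "subfield K R" "finite K"
  shows "K - {\<zero>} = {x \<in> carrier R. x [^] (card K - 1) = \<one>}"
proof -
  interpret K: field "R \<lparr>carrier := K\<rparr>"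
    using subfield_iff(2)[OF K(1)] .
  have sub: "K \<subseteq> carrier R" using subfieldE(3)[OF K(1)] .
  have "{\<zero>, \<one>} \<subseteq> K"
    using K.one_closed K.zero_closed by simp
  then have "card {\<zero>, \<one>} \<le> card K"
    by (rule card_mono[OF K(2)])
  then have pos: "0 < card K - 1" by simp
  have c: "card (K - {\<zero>}) = card K - 1"
    using K.zero_closed K(2) by simp
  have pw: "x [^]\<^bsub>Multiplicative_Group.mult_of (R\<lparr>carrier := K\<rparr>)\<^esub> n = x [^] n" for x and n :: nat
    by (induction n) auto
  have "x [^] (card K - 1) = \<one>" if "x \<in> K - {\<zero>}" for x
  proof -
    have "x [^]\<^bsub>Multiplicative_Group.mult_of (R\<lparr>carrier := K\<rparr>)\<^esub> order (Multiplicative_Group.mult_of (R\<lparr>carrier := K\<rparr>)) = \<one>\<^bsub>Multiplicative_Group.mult_of (R\<lparr>carrier := K\<rparr>)\<^esub>"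
      using that by (intro group.pow_order_eq_1[OF K.field_mult_group]) auto
    then show ?thesis
      using c by (simp add: order_def pw)
  qed
  then have "K - {\<zero>} \<subseteq> {x \<in> carrier R. x [^] (card K - 1) = \<one>}"
    using sub by auto
  then show ?thesis
    using card_roots_of_unity_le[OF pos] c by (intro card_seteq) auto
qed

lemma GF_sub_unique:
  assumes "field E" "GF_sub E p n K" "GF_sub E p n K'"
  shows "K = K'"
proof -
  interpret field E by fact
  have "K - {\<zero>\<^bsub>E\<^esub>} = K' - {\<zero>\<^bsub>E\<^esub>}"
    using assms(2,3) by (simp add: GF_sub_def finite_subfield_minus_zero)
  moreover have "\<zero>\<^bsub>E\<^esub> \<in> K" "\<zero>\<^bsub>E\<^esub> \<in> K'"
    using assms(2,3) subringE(2)[OF subfieldE(1)] by (auto simp: GF_sub_def)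
  ultimately show ?thesis by blast
qed

end

theory Submission
  imports Defs
begin

text \<open>
  Write \<open>E\<close> for the field. The proof has two halves: a field with finitely many maximal subrings is
  absolutely algebraic, and the maximal subrings of an absolutely algebraic field can be listed.

  For the first half, the source of maximal subrings is Zorn's lemma applied to the subrings that
  contain an element \<open>q\<close> but not \<open>inv q\<close>. A maximal one among these, \<open>V\<close>, is integrally closed and
  has \<open>q\<close> in its Jacobson radical, but its only proper overrings are those containing \<open>V[inv q]\<close>, so
  that \<open>V\<close> is a maximal subring of \<open>E\<close> precisely if \<open>V[inv q] = E\<close>. This is arranged by making \<open>V\<close>
  contain a ring \<open>A\<close> over which \<open>E\<close> is algebraic and whose only prime up to units of \<open>V\<close> is \<open>q\<close>
  (\<open>avoids_inv_imp_maximal_subring\<close>). If \<open>E\<close> has characteristic zero and is algebraic over the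
  integers, \<open>A\<close> is the ring of integers and \<open>q\<close> a prime number. If \<open>E\<close> has a transcendental element
  \<open>q\<close>, then \<open>A = D[q]\<close>, where \<open>D\<close> is maximal among the subrings over which \<open>q\<close> is transcendental.
  Two elements \<open>q\<close> and \<open>r\<close> that generate the unit ideal cannot share \<open>V\<close>; distinct prime numbers,
  respectively the terms of Sylvester's recursion starting at a transcendental element, therefore
  give infinitely many maximal subrings. What remains is a field algebraic over its prime field with
  \<open>p\<close> elements.

  For the second half, an absolutely algebraic field is the directed union of its finite subfields,
  and these are determined by their degrees over the prime field. The set \<open>degrees\<close> of all degrees
  that occur is closed under divisors and least common multiples, and a subring, which is
  automatically a subfield, is determined by the prime powers among the degrees of its finite
  subfields. For a prime power \<open>r\<close> there is a largest subring without a subfield of degree \<open>r\<close>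
  (\<open>subset_avoiding_subring\<close>). The maximal subrings are these for \<open>r = q\<^sup>e\<close>, where \<open>q\<close> runs through
  the primes of which a positive, but bounded, power is a degree and \<open>q\<^sup>e\<close> is the largest such power
  (\<open>maximal_subring_avoiding\<close>, \<open>maximal_subring_is_avoiding\<close>). Hence \<open>E\<close> has finitely many maximal
  subrings if and only if the set \<open>bounded_primes\<close> of such \<open>q\<close> is finite.

  The subfield \<open>L(E)\<close> collects the degrees built from the remaining, unbounded primes. It has no
  maximal subring, since it has no bounded primes. If \<open>E\<close> is finite over a subfield \<open>F\<close>, a basis lies
  in a single finite field of some degree \<open>N\<close>, and a prime power degree of \<open>E\<close> that is not a degree of
  \<open>F\<close> divides \<open>N\<close> (\<open>finite_dimension_prime_powers\<close>). For \<open>F = L(E)\<close> this bounds the bounded primes;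
  for \<open>F\<close> without maximal subrings it forces \<open>F = L(E)\<close>.
\<close>

section \<open>Algebraic elements and coefficient lists\<close>

lemma (in ring) nontrivial_list_split_first:
  assumes "\<not> set l \<subseteq> {\<zero>}"
  obtains n c l' where "l = replicate n \<zero> @ c # l'" "c \<noteq> \<zero>"
proof -
  have "\<exists>n c l'. l = replicate n \<zero> @ c # l' \<and> c \<noteq> \<zero>"
    using assms
  proof (induction l)
    case (Cons a l)
    show ?case
    proof (cases "a = \<zero>")
      case True
      then obtain n c l' where "l = replicate n \<zero> @ c # l'" "c \<noteq> \<zero>" using Cons by auto
      then have "a # l = replicate (Suc n) \<zero> @ c # l'" using True by simp
      then show ?thesis using \<open>c \<noteq> \<zero>\<close> by blast
    next
      case False
      then show ?thesis by (metis append_Nil replicate_0)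
    qed
  qed simp
  then show thesis using that by blast
qed

lemma (in domain) algebraic_iff_leading:
  assumes A: "subring A R" and x: "x \<in> carrier R"
  shows "(algebraic over A) x \<longleftrightarrow>
    (\<exists>c l. c \<in> A \<and> c \<noteq> \<zero> \<and> set l \<subseteq> A \<and> eval (c # l) x = \<zero>)"
proof
  assume "(algebraic over A) x"
  then obtain p where p: "p \<in> carrier (A[X])" "p \<noteq> []" "eval p x = \<zero>"
    using algebraicE[OF A x] by blast
  then have "polynomial A p" by (simp add: univ_poly_carrier)
  then show "\<exists>c l. c \<in> A \<and> c \<noteq> \<zero> \<and> set l \<subseteq> A \<and> eval (c # l) x = \<zero>"
    using p by (cases p) (auto simp: polynomial_def)
next
  assume "\<exists>c l. c \<in> A \<and> c \<noteq> \<zero> \<and> set l \<subseteq> A \<and> eval (c # l) x = \<zero>"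
  then obtain c l where "c \<in> A" "c \<noteq> \<zero>" "set l \<subseteq> A" "eval (c # l) x = \<zero>" by blast
  then show "(algebraic over A) x"
    by (intro algebraicI[of "c # l"]) (auto simp: sym[OF univ_poly_carrier] polynomial_def)
qed

lemma (in domain) algebraic_iff_list:
  assumes A: "subring A R" and x: "x \<in> carrier R"
  shows "(algebraic over A) x \<longleftrightarrow> (\<exists>l. set l \<subseteq> A \<and> \<not> set l \<subseteq> {\<zero>} \<and> eval l x = \<zero>)"
proof
  assume "(algebraic over A) x"
  then obtain c l where "c \<in> A \<and> c \<noteq> \<zero> \<and> set l \<subseteq> A \<and> eval (c # l) x = \<zero>"
    using algebraic_iff_leading[OF A x] by blast
  then show "\<exists>l. set l \<subseteq> A \<and> \<not> set l \<subseteq> {\<zero>} \<and> eval l x = \<zero>"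
    by (intro exI[of _ "c # l"]) auto
next
  assume "\<exists>l. set l \<subseteq> A \<and> \<not> set l \<subseteq> {\<zero>} \<and> eval l x = \<zero>"
  then obtain l where l: "set l \<subseteq> A" "\<not> set l \<subseteq> {\<zero>}" "eval l x = \<zero>" by blast
  obtain n c l' where s: "l = replicate n \<zero> @ c # l'" "c \<noteq> \<zero>"
    using nontrivial_list_split_first[OF l(2)] .
  have "set (c # l') \<subseteq> carrier R" using l(1) subringE(1)[OF A] s(1) by auto
  then have "eval (c # l') x = \<zero>" using eval_replicate[of "c # l'" x n] l(3) s(1) x by metis
  then show "(algebraic over A) x"
    using algebraic_iff_leading[OF A x] l(1) s by auto
qed

lemma (in domain) transcendental_list:
  assumes "subring A R" "x \<in> carrier R" "(transcendental over A) x"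
    and "set l \<subseteq> A" "eval l x = \<zero>"
  shows "set l \<subseteq> {\<zero>}"
  using algebraic_iff_list[OF assms(1,2)] assms(3-5) by (auto simp: over_def)

lemma (in domain) mem_simple_extension_iff:
  assumes "A \<subseteq> carrier R" "x \<in> carrier R"
  shows "y \<in> simple_extension A x \<longleftrightarrow> (\<exists>l. set l \<subseteq> A \<and> y = eval l x)"
proof
  assume "y \<in> simple_extension A x"
  then show "\<exists>l. set l \<subseteq> A \<and> y = eval l x"
    using simple_extension_as_eval_img[OF assms]
    by (metis (no_types, lifting) imageE polynomial_incl univ_poly_carrier)
next
  assume "\<exists>l. set l \<subseteq> A \<and> y = eval l x"
  then obtain l where l: "set l \<subseteq> A" "y = eval l x" by blast
  then have "eval (normalize l) x = y" using eval_normalize assms by auto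
  moreover have "normalize l \<in> carrier (A[X])"
    using normalize_gives_polynomial[OF l(1)] by (simp add: univ_poly_carrier)
  ultimately show "y \<in> simple_extension A x"
    using simple_extension_as_eval_img[OF assms] by blast
qed

lemma (in domain) eval_mem_subring:
  assumes "subring S R" "set l \<subseteq> S" "x \<in> S"
  shows "eval l x \<in> S"
proof -
  interpret S: ring "R\<lparr>carrier := S\<rparr>" by (rule subring_is_ring[OF assms(1)])
  show ?thesis
    using S.eval_in_carrier[of l x] assms by (simp add: eval_consistent)
qed

lemma (in domain) eval_map_add:
  assumes "x \<in> carrier R" "f ` set l \<subseteq> carrier R" "g ` set l \<subseteq> carrier R"
  shows "eval (map (\<lambda>r. f r \<oplus> g r) l) x = eval (map f l) x \<oplus> eval (map g l) x"
  using assms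
proof (induction l)
  case (Cons a l)
  have "eval (map f l) x \<in> carrier R" "eval (map g l) x \<in> carrier R"
    using Cons by (auto intro!: eval_in_carrier)
  then show ?case using Cons by (simp add: l_distr a_ac)
qed simp

lemma (in domain) eval_map_mult:
  assumes "x \<in> carrier R" "c \<in> carrier R" "f ` set l \<subseteq> carrier R"
  shows "eval (map (\<lambda>r. c \<otimes> f r) l) x = c \<otimes> eval (map f l) x"
  using assms
proof (induction l)
  case (Cons a l)
  have "eval (map f l) x \<in> carrier R"
    using Cons by (auto intro!: eval_in_carrier)
  then show ?case using Cons by (simp add: r_distr m_ac)
qed simp

lemma (in domain) eval_zeros:
  assumes "x \<in> carrier R" "set l \<subseteq> {\<zero>}"
  shows "eval l x = \<zero>"
  using assms by (induction l) auto

text \<open>A bivariate polynomial given by a list of coefficient rows may be evaluated row by row or column by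
  column; the induction splits off the first column.\<close>

lemma (in domain) eval_transpose:
  assumes "x \<in> carrier R" "y \<in> carrier R"
    and "\<And>r. r \<in> set rs \<Longrightarrow> set r \<subseteq> carrier R \<and> length r = m"
  shows "eval (map (\<lambda>r. eval r y) rs) x
       = eval (map (\<lambda>j. eval (map (\<lambda>r. r ! j) rs) x) [0..<m]) y"
  using assms(3)
proof (induction m arbitrary: rs)
  case 0
  then have "r = []" if "r \<in> set rs" for r using that by blast
  then have "set (map (\<lambda>r. eval r y) rs) \<subseteq> {\<zero>}" by force
  then have "eval (map (\<lambda>r. eval r y) rs) x = \<zero>" using eval_zeros[OF assms(1)] by blast
  then show ?case by simp
next
  case (Suc m)
  define col where "col j = eval (map (\<lambda>r. r ! j) rs) x" for j
  have hd: "hd r \<in> carrier R" "set (tl r) \<subseteq> carrier R" "length (tl r) = m" "r = hd r # tl r"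
    if "r \<in> set rs" for r
    using Suc.prems[OF that] by (cases r; auto)+
  have ev: "eval r y = y [^] m \<otimes> hd r \<oplus> eval (tl r) y" if "r \<in> set rs" for r
    using hd[OF that] assms(2) by (cases r) (auto simp: m_comm)
  have "eval (map (\<lambda>r. eval r y) rs) x = eval (map (\<lambda>r. y [^] m \<otimes> hd r \<oplus> eval (tl r) y) rs) x"
    using ev by (metis (no_types, lifting) map_eq_conv)
  also have "\<dots> = eval (map (\<lambda>r. y [^] m \<otimes> hd r) rs) x \<oplus> eval (map (\<lambda>r. eval (tl r) y) rs) x"
    using hd assms(1,2) by (intro eval_map_add) (auto intro!: eval_in_carrier)
  also have "eval (map (\<lambda>r. y [^] m \<otimes> hd r) rs) x = y [^] m \<otimes> eval (map hd rs) x"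
    using hd assms(1,2) by (intro eval_map_mult) auto
  also have "map hd rs = map (\<lambda>r. r ! 0) rs"
    using hd(4) by (auto simp: hd_conv_nth) (metis list.distinct(1) hd_conv_nth)
  also have "map (\<lambda>r. eval (tl r) y) rs = map (\<lambda>r. eval r y) (map tl rs)" by simp
  also have "eval (map (\<lambda>r. eval r y) (map tl rs)) x
      = eval (map (\<lambda>j. eval (map (\<lambda>r. r ! j) (map tl rs)) x) [0..<m]) y"
    by (rule Suc.IH) (use hd in auto)
  also have "map (\<lambda>j. eval (map (\<lambda>r. r ! j) (map tl rs)) x) [0..<m] = map (\<lambda>j. col (Suc j)) [0..<m]"
  proof (rule map_cong[OF refl])
    fix j assume "j \<in> set [0..<m]"
    then have "map (\<lambda>r. r ! j) (map tl rs) = map (\<lambda>r. r ! Suc j) rs"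
      using hd(3) by (auto simp: nth_tl)
    then show "eval (map (\<lambda>r. r ! j) (map tl rs)) x = col (Suc j)" unfolding col_def by (simp only:)
  qed
  finally have e: "eval (map (\<lambda>r. eval r y) rs) x
      = y [^] m \<otimes> col 0 \<oplus> eval (map (\<lambda>j. col (Suc j)) [0..<m]) y"
    unfolding col_def .
  have u: "[0..<Suc m] = 0 # map Suc [0..<m]" by (simp add: upt_conv_Cons map_Suc_upt del: upt_Suc)
  have m: "map col [0..<Suc m] = col 0 # map (\<lambda>j. col (Suc j)) [0..<m]"
    unfolding u by simp
  have c0: "col 0 \<in> carrier R"
    unfolding col_def using Suc.prems assms(1)
    by (intro eval_in_carrier) (fastforce dest!: nth_mem)+
  have "eval (map col [0..<Suc m]) y = y [^] m \<otimes> col 0 \<oplus> eval (map (\<lambda>j. col (Suc j)) [0..<m]) y"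
    unfolding m using c0 assms(2) by (simp add: m_comm)
  then show ?case using e unfolding col_def by simp
qed

text \<open>Transposing a list of coefficient rows turns a relation for \<open>x\<close> over \<open>D[y]\<close> into one for
  \<open>y\<close> over \<open>D[x]\<close>; it stays nontrivial because \<open>x\<close> satisfies no relation over \<open>D\<close>. Working over
  the ring \<open>D[y]\<close> instead of the field \<open>D(y)\<close> avoids clearing denominators.\<close>

lemma (in domain) algebraic_exchange:
  assumes D: "subring D R" and x: "x \<in> carrier R" and y: "y \<in> carrier R"
    and alg: "(algebraic over (simple_extension D y)) x"
    and tr: "(transcendental over D) x"
  shows "(algebraic over (simple_extension D x)) y"
proof -
  have Dc: "D \<subseteq> carrier R" using subringE(1)[OF D] .
  obtain l where l: "set l \<subseteq> simple_extension D y" "\<not> set l \<subseteq> {\<zero>}" "eval l x = \<zero>"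
    using algebraic_iff_list[OF simple_extension_is_subring[OF D y] x] alg by blast
  have "\<forall>c\<in>set l. \<exists>r. set r \<subseteq> D \<and> c = eval r y"
    using l(1) mem_simple_extension_iff[OF Dc y] by blast
  then obtain row where row: "\<And>c. c \<in> set l \<Longrightarrow> set (row c) \<subseteq> D \<and> c = eval (row c) y" by metis
  define m where "m = Max (length ` row ` set l)"
  define pad where "pad c = replicate (m - length (row c)) \<zero> @ row c" for c
  have pad: "set (pad c) \<subseteq> D" "length (pad c) = m" "eval (pad c) y = c" if "c \<in> set l" for c
  proof -
    have "length (row c) \<le> m" unfolding m_def using that by (intro Max_ge) auto
    then show "length (pad c) = m" unfolding pad_def by simp
    show "set (pad c) \<subseteq> D" unfolding pad_def using row[OF that] subringE(2)[OF D] by auto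
    show "eval (pad c) y = c"
      unfolding pad_def using row[OF that] eval_replicate[of "row c" y] y Dc by auto
  qed
  define rs where "rs = map pad l"
  have rs: "set r \<subseteq> D" "length r = m" if "r \<in> set rs" for r
    using that pad unfolding rs_def by auto
  have "map (\<lambda>r. eval r y) rs = l"
    unfolding rs_def using pad(3) by (simp add: map_idI)
  then have z: "eval (map (\<lambda>j. eval (map (\<lambda>r. r ! j) rs) x) [0..<m]) y = \<zero>"
    using eval_transpose[OF x y, of rs m] rs Dc l(3) by (metis subset_trans)
  have col: "set (map (\<lambda>r. r ! j) rs) \<subseteq> D" if "j < m" for j
    using rs that by (fastforce dest!: nth_mem)
  have "\<exists>j<m. eval (map (\<lambda>r. r ! j) rs) x \<noteq> \<zero>"
  proof (rule ccontr)
    assume "\<not> ?thesis"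
    then have "set (map (\<lambda>r. r ! j) rs) \<subseteq> {\<zero>}" if "j < m" for j
      using transcendental_list[OF D x tr col] that by blast
    then have "set (pad c) \<subseteq> {\<zero>}" if "c \<in> set l" for c
      using that pad(2)[OF that] unfolding rs_def by (force simp: in_set_conv_nth)
    then have "c = \<zero>" if "c \<in> set l" for c
      using pad(3)[OF that] eval_zeros[OF y] that by metis
    then show False using l(2) by blast
  qed
  then have "\<not> set (map (\<lambda>j. eval (map (\<lambda>r. r ! j) rs) x) [0..<m]) \<subseteq> {\<zero>}"
    by (auto simp: image_subset_iff)
  moreover have "set (map (\<lambda>j. eval (map (\<lambda>r. r ! j) rs) x) [0..<m]) \<subseteq> simple_extension D x"
  proof -
    have "eval (map (\<lambda>r. r ! j) rs) x \<in> simple_extension D x" if "j < m" for j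
      using mem_simple_extension_iff[OF Dc x] col[OF that] by blast
    then show ?thesis by auto
  qed
  ultimately show ?thesis
    using algebraic_iff_list[OF simple_extension_is_subring[OF D x] y] z by blast
qed

section \<open>Subrings maximal among those avoiding an inverse\<close>

text \<open>In a field, and for \<open>s \<noteq> 0\<close>, this is the localization of \<open>V\<close> at the powers of \<open>s\<close>; describing it by
  denominators makes its closure properties and its elements explicit.\<close>

lemma (in domain) subring_denominators:
  assumes V: "subring V R" and s: "s \<in> V"
  shows "subring {x \<in> carrier R. \<exists>n::nat. s [^] n \<otimes> x \<in> V} R" (is "subring ?D R")
proof (rule subringI)
  note E = subringE[OF V]
  have sc: "s \<in> carrier R" using E s by blast
  have pw: "s [^] (n::nat) \<in> V" for n
    using s E by (induction n) auto
  show "?D \<subseteq> carrier R" by blast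
  show "\<one> \<in> ?D" using E(3) by (auto intro!: exI[of _ "0::nat"])
  show "\<ominus> h \<in> ?D" if h: "h \<in> ?D" for h
  proof -
    obtain n :: nat where "h \<in> carrier R" "s [^] n \<otimes> h \<in> V" using h by blast
    moreover have "s [^] n \<otimes> \<ominus> h = \<ominus> (s [^] n \<otimes> h)" using calculation sc by (simp add: r_minus)
    ultimately have "s [^] n \<otimes> \<ominus> h \<in> V" "\<ominus> h \<in> carrier R" using E(5) by auto
    then show ?thesis by blast
  qed
  fix h1 h2 assume "h1 \<in> ?D" "h2 \<in> ?D"
  then obtain n m :: nat where h: "h1 \<in> carrier R" "h2 \<in> carrier R"
    "s [^] n \<otimes> h1 \<in> V" "s [^] m \<otimes> h2 \<in> V" by blast
  have "s [^] (n + m) \<otimes> (h1 \<otimes> h2) = (s [^] n \<otimes> h1) \<otimes> (s [^] m \<otimes> h2)"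
    using h sc by (simp add: nat_pow_mult[symmetric] m_ac)
  then have "s [^] (n + m) \<otimes> (h1 \<otimes> h2) \<in> V" using h E by simp
  then show "h1 \<otimes> h2 \<in> ?D" using h by blast
  have "s [^] (n + m) \<otimes> (h1 \<oplus> h2) = s [^] m \<otimes> (s [^] n \<otimes> h1) \<oplus> s [^] n \<otimes> (s [^] m \<otimes> h2)"
    using h sc by (simp add: nat_pow_mult[symmetric] m_ac r_distr)
  then have "s [^] (n + m) \<otimes> (h1 \<oplus> h2) \<in> V" using h E pw by simp
  then show "h1 \<oplus> h2 \<in> ?D" using h by blast
qed

lemma (in ring) subring_chain_Union:
  assumes "\<C> \<noteq> {}" "subset.chain {S. subring S R} \<C>"
  shows "subring (\<Union>\<C>) R"
proof (rule subringI)
  have C: "subring S R" if "S \<in> \<C>" for S using assms(2) that by (auto simp: subset_chain_def)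
  show "\<Union>\<C> \<subseteq> carrier R" using subringE(1)[OF C] by (rule Union_least)
  show "\<one> \<in> \<Union>\<C>" using subringE(3)[OF C] assms(1) by (auto simp: ex_in_conv[symmetric])
  show "\<ominus> h \<in> \<Union>\<C>" if "h \<in> \<Union>\<C>" for h
  proof -
    obtain S where "S \<in> \<C>" "h \<in> S" using \<open>h \<in> \<Union>\<C>\<close> by (rule UnionE)
    then show ?thesis using subringE(5)[OF C] by (intro UnionI)
  qed
  fix h1 h2 assume h: "h1 \<in> \<Union>\<C>" "h2 \<in> \<Union>\<C>"
  then obtain S T where "S \<in> \<C>" "T \<in> \<C>" "h1 \<in> S" "h2 \<in> T" by blast
  moreover have "S \<subseteq> T \<or> T \<subseteq> S"
    using \<open>S \<in> \<C>\<close> \<open>T \<in> \<C>\<close> assms(2) unfolding subset_chain_def by metis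
  ultimately obtain U where "U \<in> \<C>" "h1 \<in> U" "h2 \<in> U" by (metis subsetD)
  then show "h1 \<otimes> h2 \<in> \<Union>\<C>" "h1 \<oplus> h2 \<in> \<Union>\<C>"
    using subringE(6,7)[OF C[OF \<open>U \<in> \<C>\<close>]] by (meson UnionI)+
qed

text \<open>In a field such a \<open>V\<close> behaves like a valuation ring whose maximal ideal contains \<open>q\<close>: the
  condition \<open>inv q \<notin> V\<close> says that a nonzero \<open>q\<close> is a nonunit of \<open>V\<close>.\<close>

definition (in ring) avoids_inv :: "'a \<Rightarrow> 'a set \<Rightarrow> bool" where
  "avoids_inv q V \<longleftrightarrow> subring V R \<and> q \<in> V \<and> inv q \<notin> V \<and>
     (\<forall>T. subring T R \<longrightarrow> V \<subseteq> T \<longrightarrow> inv q \<notin> T \<longrightarrow> T = V)"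

lemma (in ring) avoids_inv_exists:
  assumes A: "subring A R" "q \<in> A" "inv q \<notin> A"
  obtains V where "A \<subseteq> V" "avoids_inv q V"
proof -
  define \<A> where "\<A> = {S. subring S R \<and> A \<subseteq> S \<and> inv q \<notin> S}"
  have "A \<in> \<A>" unfolding \<A>_def using A by blast
  moreover have "\<Union>\<C> \<in> \<A>" if chain: "\<C> \<noteq> {}" "subset.chain \<A> \<C>" for \<C>
  proof -
    have sub: "\<C> \<subseteq> \<A>" and "subset.chain {S. subring S R} \<C>"
      using chain(2) by (auto simp: \<A>_def subset_chain_def)
    then have "subring (\<Union>\<C>) R" using subring_chain_Union[OF chain(1)] by blast
    moreover obtain S where "S \<in> \<C>" using chain(1) by blast
    moreover have "A \<subseteq> S" "inv q \<notin> \<Union>\<C>" using sub \<open>S \<in> \<C>\<close> unfolding \<A>_def by auto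
    ultimately show ?thesis unfolding \<A>_def by blast
  qed
  ultimately have "\<exists>M\<in>\<A>. \<forall>Y\<in>\<A>. M \<subseteq> Y \<longrightarrow> Y = M"
    by (intro subset_Zorn_nonempty) auto
  then obtain M where M: "M \<in> \<A>" "\<And>Y. Y \<in> \<A> \<Longrightarrow> M \<subseteq> Y \<Longrightarrow> Y = M" by metis
  then have "subring M R" "A \<subseteq> M" "inv q \<notin> M" unfolding \<A>_def by auto
  moreover have "T = M" if "subring T R" "M \<subseteq> T" "inv q \<notin> T" for T
    using M(2)[of T] that calculation unfolding \<A>_def by auto
  ultimately have "avoids_inv q M" "A \<subseteq> M"
    unfolding avoids_inv_def using A by auto
  then show thesis using that by blast
qed

context field
begin

lemma inv_carrier: "x \<in> carrier R \<Longrightarrow> x \<noteq> \<zero> \<Longrightarrow> inv x \<in> carrier R"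
  and r_inv_nonzero: "x \<in> carrier R \<Longrightarrow> x \<noteq> \<zero> \<Longrightarrow> x \<otimes> inv x = \<one>"
  and l_inv_nonzero: "x \<in> carrier R \<Longrightarrow> x \<noteq> \<zero> \<Longrightarrow> inv x \<otimes> x = \<one>"
  using field_Units by auto

lemma inv_unique_field: "x \<in> carrier R \<Longrightarrow> y \<in> carrier R \<Longrightarrow> x \<otimes> y = \<one> \<Longrightarrow> inv x = y"
  by (rule comm_inv_char)

lemma pow_nonzero: "x \<in> carrier R \<Longrightarrow> x \<noteq> \<zero> \<Longrightarrow> x [^] (n::nat) \<noteq> \<zero>"
  by (induction n) (auto simp: integral_iff)

lemma pow_mem_subring: "subring S R \<Longrightarrow> x \<in> S \<Longrightarrow> x [^] (n::nat) \<in> S"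
  using subringE(3,6)[of S R] by (induction n) auto

text \<open>Powers of \<open>1 - q v\<close> stay in \<open>1 - q V\<close>, so inverting \<open>1 - q v\<close> cannot produce \<open>inv q\<close>;
  maximality then puts the inverse into \<open>V\<close>. In other words \<open>q\<close> lies in the Jacobson radical of \<open>V\<close>.\<close>

lemma avoids_inv_unit:
  assumes V: "avoids_inv q V" and q: "q \<noteq> \<zero>" and v: "v \<in> V"
  shows "\<one> \<ominus> q \<otimes> v \<noteq> \<zero>" "inv (\<one> \<ominus> q \<otimes> v) \<in> V"
proof -
  have sub: "subring V R" and qV: "q \<in> V" and nin: "inv q \<notin> V"
    and mx: "\<And>T. subring T R \<Longrightarrow> V \<subseteq> T \<Longrightarrow> inv q \<notin> T \<Longrightarrow> T = V"
    using V unfolding avoids_inv_def by blast+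
  note E = subringE[OF sub]
  have qc: "q \<in> carrier R" and vc: "v \<in> carrier R" using qV v E by auto
  let ?s = "\<one> \<ominus> q \<otimes> v"
  have sV: "?s \<in> V" using E v qV by (simp add: a_minus_def)
  have sc: "?s \<in> carrier R" using qc vc by simp
  show nz: "?s \<noteq> \<zero>"
  proof
    assume "?s = \<zero>"
    then have "q \<otimes> v = \<one>" using qc vc r_right_minus_eq[of \<one> "q \<otimes> v"] by simp
    then show False using inv_unique_field[OF qc vc] nin v by simp
  qed
  have pw: "\<exists>v'\<in>V. ?s [^] n = \<one> \<ominus> q \<otimes> v'" for n :: nat
  proof (induction n)
    case 0
    have "\<one> = \<one> \<ominus> q \<otimes> \<zero>" using qc by (simp add: a_minus_def)
    then show ?case using E(2) by (metis nat_pow_0)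
  next
    case (Suc n)
    then obtain v' where v': "v' \<in> V" "?s [^] n = \<one> \<ominus> q \<otimes> v'" by blast
    then have v'c: "v' \<in> carrier R" using E by blast
    have "?s [^] Suc n = (\<one> \<ominus> q \<otimes> v') \<otimes> (\<one> \<ominus> q \<otimes> v)" using v' by simp
    also have "\<dots> = \<one> \<ominus> q \<otimes> (v' \<oplus> v \<ominus> q \<otimes> v' \<otimes> v)"
      using qc vc v'c by algebra
    finally show ?case using v' v qV E by (metis a_minus_def)
  qed
  show "inv ?s \<in> V"
  proof (rule ccontr)
    assume n: "inv ?s \<notin> V"
    let ?D = "{x \<in> carrier R. \<exists>n::nat. ?s [^] n \<otimes> x \<in> V}"
    have "V \<subseteq> ?D" using E(1) by (auto intro!: exI[of _ "0::nat"])
    moreover have "inv ?s \<in> ?D"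
      using inv_carrier[OF sc nz] r_inv_nonzero[OF sc nz] E(3) sc by (auto intro!: exI[of _ "1::nat"])
    ultimately have "inv q \<in> ?D" using mx[OF subring_denominators[OF sub sV]] n by blast
    then obtain n :: nat where n: "?s [^] n \<otimes> inv q \<in> V" by blast
    obtain v' where v': "v' \<in> V" "?s [^] n = \<one> \<ominus> q \<otimes> v'" using pw by blast
    then have v'c: "v' \<in> carrier R" using E by blast
    have ic: "inv q \<in> carrier R" "q \<otimes> inv q = \<one>"
      using inv_carrier[OF qc q] r_inv_nonzero[OF qc q] by auto
    have "inv q = (\<one> \<ominus> q \<otimes> v') \<otimes> inv q \<oplus> v' \<otimes> (q \<otimes> inv q)"
      using ic(1) v'c qc by algebra
    also have "\<dots> = ?s [^] n \<otimes> inv q \<oplus> v'" using ic v'c v' by simp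
    finally show False using n v' nin E(7) by metis
  qed
qed

text \<open>Suppose that \<open>f\<close> is a root of a monic polynomial of degree \<open>k + 1\<close> over \<open>V\<close> but not in \<open>V\<close>. Then
  \<open>V[f]\<close> contains \<open>inv q\<close> by maximality and is spanned over \<open>V\<close> by the powers of \<open>f\<close> up to the \<open>k\<close>-th.
  So the \<open>k\<close>-th power is \<open>q\<close> times a combination of these powers, and as \<open>1 - q V\<close> consists of units
  this is a monic relation of degree \<open>k\<close>, to which induction applies.\<close>

lemma avoids_inv_integrally_closed:
  assumes V: "avoids_inv q V" and q: "q \<noteq> \<zero>" and f: "f \<in> carrier R"
    and l: "set l \<subseteq> V" "eval (\<one> # l) f = \<zero>"
  shows "f \<in> V"
  using l
proof (induction "length l" arbitrary: l rule: less_induct)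
  case less
  have sub: "subring V R" and qV: "q \<in> V" and nin: "inv q \<notin> V"
    and mx: "\<And>T. subring T R \<Longrightarrow> V \<subseteq> T \<Longrightarrow> inv q \<notin> T \<Longrightarrow> T = V"
    using V unfolding avoids_inv_def by blast+
  note E = subringE[OF sub]
  have qc: "q \<in> carrier R" using qV E by auto
  have ic: "inv q \<in> carrier R" "q \<otimes> inv q = \<one>"
    using inv_carrier[OF qc q] r_inv_nonzero[OF qc q] by auto
  show ?case
  proof (rule ccontr)
    assume fV: "f \<notin> V"
    have lc: "set l \<subseteq> carrier R" using less.prems E by blast
    have evl: "eval l f \<in> carrier R" using eval_in_carrier[OF lc f] .
    obtain k where k: "length l = Suc k"
    proof (cases l)
      case Nil
      then show ?thesis using less.prems by simp
    next
      case (Cons a b)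
      then show ?thesis using that by simp
    qed
    have top: "f [^] Suc k = \<ominus> eval l f"
      using less.prems(2) k evl f minus_equality[of "f [^] Suc k" "eval l f"] by simp
    \<comment> \<open>the span of the powers of \<open>f\<close> up to the \<open>k\<close>-th\<close>
    define M where "M = {eval r f | r. set r \<subseteq> V \<and> length r = Suc k}"
    have M_add: "a \<oplus> b \<in> M" if ab: "a \<in> M" "b \<in> M" for a b
    proof -
      obtain r s where r: "set r \<subseteq> V" "length r = Suc k" "a = eval r f"
        and s: "set s \<subseteq> V" "length s = Suc k" "b = eval s f"
        using ab unfolding M_def by blast
      define g where "g i = r ! i" for i
      define h where "h i = s ! i" for i
      have gh: "g ` set [0..<Suc k] \<subseteq> V" "h ` set [0..<Suc k] \<subseteq> V"
        using r s unfolding g_def h_def by (auto simp del: upt_Suc)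
      have rs: "map g [0..<Suc k] = r" "map h [0..<Suc k] = s"
        unfolding g_def h_def using r s by (metis map_nth)+
      have "eval (map (\<lambda>i. g i \<oplus> h i) [0..<Suc k]) f = a \<oplus> b"
        using eval_map_add[OF f, of g "[0..<Suc k]" h] gh E(1) rs r s
        by (auto simp del: upt_Suc)
      moreover have "set (map (\<lambda>i. g i \<oplus> h i) [0..<Suc k]) \<subseteq> V"
        using gh E(7) by (auto simp del: upt_Suc)
      ultimately show ?thesis unfolding M_def
        by (metis (mono_tags, lifting) diff_zero length_map length_upt mem_Collect_eq)
    qed
    have M_smult: "c \<otimes> a \<in> M" if ca: "c \<in> V" "a \<in> M" for c a
    proof -
      obtain r where r: "set r \<subseteq> V" "length r = Suc k" "a = eval r f"
        using ca unfolding M_def by blast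
      have "eval (map (\<lambda>x. c \<otimes> x) r) f = c \<otimes> a"
        using eval_map_mult[OF f, of c "\<lambda>x. x" r] ca r E(1) by auto
      moreover have "set (map (\<lambda>x. c \<otimes> x) r) \<subseteq> V" using r ca E(6) by auto
      ultimately show ?thesis unfolding M_def using r
        by (metis (mono_tags, lifting) length_map mem_Collect_eq)
    qed
    have M_low: "eval r f \<in> M" if "set r \<subseteq> V" "length r \<le> Suc k" for r
    proof -
      have "eval (replicate (Suc k - length r) \<zero> @ r) f = eval r f"
        using eval_replicate[of r f] that E(1) f by blast
      moreover have "set (replicate (Suc k - length r) \<zero> @ r) \<subseteq> V" using that E(2) by auto
      moreover have "length (replicate (Suc k - length r) \<zero> @ r) = Suc k" using that by simp
      ultimately show ?thesis unfolding M_def by (metis (mono_tags, lifting) mem_Collect_eq)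
    qed
    have M_f: "a \<otimes> f \<in> M" if a: "a \<in> M" for a
    proof -
      obtain r where r: "set r \<subseteq> V" "length r = Suc k" "a = eval r f"
        using a unfolding M_def by blast
      obtain c s where cs: "r = c # s" "length s = k" using r(2) by (cases r) auto
      have cV: "c \<in> V" "set s \<subseteq> V" using cs r by auto
      have cc: "c \<in> carrier R" "set s \<subseteq> carrier R" using cV E by blast+
      have es: "eval s f \<in> carrier R" using eval_in_carrier[OF cc(2) f] .
      have "a \<otimes> f = (c \<otimes> f [^] k \<oplus> eval s f) \<otimes> f" using r cs by simp
      also have "\<dots> = c \<otimes> f [^] Suc k \<oplus> eval s f \<otimes> f"
        using cc f es by (simp add: l_distr m_assoc)
      also have "\<dots> = (\<ominus> c) \<otimes> eval l f \<oplus> eval s f \<otimes> f"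
        unfolding top using cc evl by (simp add: l_minus r_minus)
      also have "eval s f \<otimes> f = eval (s @ [\<zero>]) f"
        using eval_append_aux[OF cc(2) zero_closed f] es f by simp
      finally have "a \<otimes> f = (\<ominus> c) \<otimes> eval l f \<oplus> eval (s @ [\<zero>]) f" .
      moreover have "eval l f \<in> M" using less.prems k by (intro M_low) auto
      moreover have "eval (s @ [\<zero>]) f \<in> M" using cs cV E(2) by (intro M_low) auto
      ultimately show ?thesis using M_add M_smult cV E(5) by metis
    qed
    have M_V: "v \<in> M" if "v \<in> V" for v
      using M_low[of "[v]"] that E(1) by auto
    have ext: "simple_extension V f \<subseteq> M"
    proof
      fix x assume "x \<in> simple_extension V f"
      then show "x \<in> M"
      proof (induction rule: simple_extension.induct)
        case zero
        then show ?case using M_V E(2) by blast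
      next
        case (lin k1 k2)
        then show ?case using M_add[OF M_f M_V] by blast
      qed
    qed
    have se: "subring (simple_extension V f) R" by (rule simple_extension_is_subring[OF sub f])
    have "V \<subseteq> simple_extension V f" "f \<in> simple_extension V f"
      using simple_extension_incl[OF E(1) f] simple_extension_mem[OF sub f] by auto
    then have inq: "inv q \<in> simple_extension V f" using mx[OF se] fV by blast
    have "f [^] k \<in> simple_extension V f"
      using pow_mem_subring[OF se] \<open>f \<in> simple_extension V f\<close> .
    then have "inv q \<otimes> f [^] k \<in> M" using inq ext subringE(6)[OF se] by blast
    then obtain r where r: "set r \<subseteq> V" "length r = Suc k" "inv q \<otimes> f [^] k = eval r f"
      unfolding M_def by blast
    obtain c s where cs: "r = c # s" "length s = k" using r(2) by (cases r) auto
    have cV: "c \<in> V" "set s \<subseteq> V" using cs r by auto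
    have cc: "c \<in> carrier R" "set s \<subseteq> carrier R" using cV E by blast+
    have es: "eval s f \<in> carrier R" using eval_in_carrier[OF cc(2) f] .
    let ?u = "\<one> \<ominus> q \<otimes> c"
    have u: "?u \<noteq> \<zero>" "inv ?u \<in> V" using avoids_inv_unit[OF V q cV(1)] .
    have uc: "?u \<in> carrier R" using qc cc by simp
    have fk: "f [^] k \<in> carrier R" using f by simp
    have "f [^] k = q \<otimes> (inv q \<otimes> f [^] k)" using ic fk qc by (simp add: m_assoc[symmetric])
    also have "\<dots> = q \<otimes> (c \<otimes> f [^] k \<oplus> eval s f)" using r cs by simp
    finally have e: "f [^] k = q \<otimes> (c \<otimes> f [^] k \<oplus> eval s f)" .
    have "?u \<otimes> f [^] k = f [^] k \<ominus> q \<otimes> (c \<otimes> f [^] k)"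
      using fk cc qc by algebra
    also have "\<dots> = q \<otimes> (c \<otimes> f [^] k \<oplus> eval s f) \<ominus> q \<otimes> (c \<otimes> f [^] k)"
      using e by metis
    also have "\<dots> = q \<otimes> eval s f"
      using fk cc qc es by algebra
    finally have ufk: "?u \<otimes> f [^] k = q \<otimes> eval s f" .
    have iu: "inv ?u \<in> carrier R" "inv ?u \<otimes> ?u = \<one>"
      using u uc inv_carrier l_inv_nonzero by auto
    have "f [^] k = (inv ?u \<otimes> ?u) \<otimes> f [^] k" using iu fk by simp
    also have "\<dots> = inv ?u \<otimes> (?u \<otimes> f [^] k)" by (rule m_assoc[OF iu(1) uc fk])
    also have "\<dots> = (inv ?u \<otimes> q) \<otimes> eval s f"
      unfolding ufk by (rule m_assoc[OF iu(1) qc es, symmetric])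
    finally have fk2: "f [^] k = (inv ?u \<otimes> q) \<otimes> eval s f" .
    define w where "w = \<ominus> (inv ?u \<otimes> q)"
    have w: "w \<in> V" "w \<in> carrier R" unfolding w_def using u qV E by auto
    have ew: "eval (map (\<lambda>x. w \<otimes> x) s) f = w \<otimes> eval s f"
      using eval_map_mult[OF f w(2), of "\<lambda>x. x" s] cc by simp
    have "eval (\<one> # map (\<lambda>x. w \<otimes> x) s) f = f [^] k \<oplus> w \<otimes> eval s f"
      using ew cs fk by simp
    also have "\<dots> = \<zero>"
      unfolding fk2 w_def using iu qc es by (simp add: l_minus r_neg)
    finally have "eval (\<one> # map (\<lambda>x. w \<otimes> x) s) f = \<zero>" .
    moreover have "set (map (\<lambda>x. w \<otimes> x) s) \<subseteq> V" using w cV E(6) by auto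
    ultimately have "f \<in> V" using less.hyps[of "map (\<lambda>x. w \<otimes> x) s"] cs k by simp
    then show False using fV by blast
  qed
qed

text \<open>Multiplying a polynomial of degree \<open>n\<close> by \<open>c\<^sup>n\<close> allows one to absorb a factor \<open>c\<close> into each occurrence
  of the variable. The exponent below is the formal degree of the list.\<close>

lemma eval_scale:
  assumes A: "subring A R" and c: "c \<in> A" and y: "y \<in> carrier R" and l: "set l \<subseteq> A"
  shows "\<exists>l'. set l' \<subseteq> A \<and> length l' = length l \<and>
    eval l' (c \<otimes> y) = c [^] (length l - 1) \<otimes> eval l y"
  using l
proof (induction l)
  case Nil
  then show ?case using c y subringE(1)[OF A] by auto
next
  case (Cons a l)
  note E = subringE[OF A]
  have cc: "c \<in> carrier R" "a \<in> carrier R" "set l \<subseteq> carrier R" using c E Cons by auto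
  have el: "eval l y \<in> carrier R" using eval_in_carrier[OF cc(3) y] .
  obtain l' where l': "set l' \<subseteq> A" "length l' = length l"
    "eval l' (c \<otimes> y) = c [^] (length l - 1) \<otimes> eval l y"
    using Cons by auto
  have lc': "set l' \<subseteq> carrier R" using l' E by blast
  have sc: "eval (map (\<lambda>x. c \<otimes> x) l') (c \<otimes> y) = c \<otimes> eval l' (c \<otimes> y)"
    using eval_map_mult[of "c \<otimes> y" c "\<lambda>x. x" l'] cc y lc' by simp
  have cl: "c \<otimes> eval l' (c \<otimes> y) = c [^] length l \<otimes> eval l y"
  proof (cases l)
    case Nil
    then show ?thesis using l' cc by simp
  next
    case (Cons b m)
    have "c \<otimes> (c [^] length m \<otimes> eval l y) = c [^] Suc (length m) \<otimes> eval l y"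
      using cc el by (simp add: m_ac)
    then show ?thesis using l'(3) Cons by simp
  qed
  have "eval (a # map (\<lambda>x. c \<otimes> x) l') (c \<otimes> y)
      = a \<otimes> (c \<otimes> y) [^] length l \<oplus> c [^] length l \<otimes> eval l y"
    using sc cl l'(2) by simp
  also have "\<dots> = c [^] length l \<otimes> (a \<otimes> y [^] length l \<oplus> eval l y)"
    using cc y el by (simp add: nat_pow_distrib r_distr m_ac)
  also have "\<dots> = c [^] (length (a # l) - 1) \<otimes> eval (a # l) y" by simp
  finally show ?case using l' Cons.prems c E(6) by (intro exI[of _ "a # map (\<lambda>x. c \<otimes> x) l'"]) auto
qed

text \<open>A relation for \<open>y\<close> with leading coefficient \<open>c\<close>, multiplied by a power of \<open>c\<close>, is a monic relation
  for \<open>c y\<close>.\<close>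

lemma integral_multiple:
  assumes A: "subring A R" and y: "y \<in> carrier R"
    and c: "c \<in> A" "c \<noteq> \<zero>" and l: "set l \<subseteq> A" "eval (c # l) y = \<zero>"
  obtains l' where "set l' \<subseteq> A" "eval (\<one> # l') (c \<otimes> y) = \<zero>"
proof -
  note E = subringE[OF A]
  have cc: "c \<in> carrier R" "set l \<subseteq> carrier R" using c l E by auto
  have el: "eval l y \<in> carrier R" using eval_in_carrier[OF cc(2) y] .
  obtain l' where l': "set l' \<subseteq> A" "length l' = length l"
    "eval l' (c \<otimes> y) = c [^] (length l - 1) \<otimes> eval l y"
    using eval_scale[OF A c(1) y l(1)] by blast
  obtain k where k: "length l = Suc k"
    using l(2) c cc by (cases l) auto
  have "eval (\<one> # l') (c \<otimes> y) = (c \<otimes> y) [^] Suc k \<oplus> c [^] k \<otimes> eval l y"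
    using l' k cc y by simp
  also have "\<dots> = c [^] k \<otimes> (c \<otimes> y [^] Suc k \<oplus> eval l y)"
    using cc y el by (simp add: nat_pow_distrib r_distr m_ac del: nat_pow_Suc)
  also have "c \<otimes> y [^] Suc k \<oplus> eval l y = \<zero>" using l(2) k by simp
  finally show thesis using that l' cc by auto
qed

text \<open>The hypothesis on \<open>A\<close> says that, up to units of \<open>V\<close>, the only prime of \<open>A\<close> is \<open>q\<close>. Since \<open>R\<close>
  is algebraic over \<open>A\<close> and \<open>V\<close> is integrally closed, every element of \<open>R\<close> then falls into \<open>V\<close>
  after multiplication by a power of \<open>q\<close>, so that adjoining \<open>inv q\<close> to \<open>V\<close> gives all of \<open>R\<close>.\<close>

lemma avoids_inv_imp_maximal_subring:
  assumes V: "avoids_inv q V" and q: "q \<noteq> \<zero>"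
    and A: "subring A R" "A \<subseteq> V"
    and alg: "\<And>y. y \<in> carrier R \<Longrightarrow> (algebraic over A) y"
    and prim: "\<And>a. a \<in> A \<Longrightarrow> a \<noteq> \<zero> \<Longrightarrow> \<exists>n::nat. \<exists>u\<in>V. a = q [^] n \<otimes> u \<and> u \<noteq> \<zero> \<and> inv u \<in> V"
  shows "maximal_subring V R"
  unfolding maximal_subring_def
proof (intro conjI allI impI)
  have sub: "subring V R" and qV: "q \<in> V" and nin: "inv q \<notin> V"
    and mx: "\<And>T. subring T R \<Longrightarrow> V \<subseteq> T \<Longrightarrow> inv q \<notin> T \<Longrightarrow> T = V"
    using V unfolding avoids_inv_def by blast+
  note E = subringE[OF sub]
  have qc: "q \<in> carrier R" using qV E by auto
  have ic: "inv q \<in> carrier R" "inv q \<otimes> q = \<one>"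
    using inv_carrier[OF qc q] l_inv_nonzero[OF qc q] by auto
  show "subring V R" by (rule sub)
  show "V \<noteq> carrier R" using nin ic by blast
  fix T assume T: "subring T R" "V \<subseteq> T"
  have den: "\<exists>n::nat. q [^] n \<otimes> y \<in> V" if y: "y \<in> carrier R" for y
  proof -
    obtain c l where c: "c \<in> A" "c \<noteq> \<zero>" "set l \<subseteq> A" "eval (c # l) y = \<zero>"
      using algebraic_iff_leading[OF A(1) y] alg[OF y] by blast
    obtain l' where l': "set l' \<subseteq> A" "eval (\<one> # l') (c \<otimes> y) = \<zero>"
      using integral_multiple[OF A(1) y c] by blast
    have cc: "c \<in> carrier R" using c A E by blast
    have cy: "c \<otimes> y \<in> V"
      using avoids_inv_integrally_closed[OF V q, of "c \<otimes> y" l'] l' A(2) cc y by auto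
    obtain n :: nat and u where u: "u \<in> V" "c = q [^] n \<otimes> u" "u \<noteq> \<zero>" "inv u \<in> V"
      using prim[OF c(1,2)] by blast
    have uc: "u \<in> carrier R" "inv u \<in> carrier R" "inv u \<otimes> u = \<one>"
      using u E l_inv_nonzero by auto
    have "inv u \<otimes> (c \<otimes> y) = (inv u \<otimes> u) \<otimes> (q [^] n \<otimes> y)"
      unfolding u(2) using uc(1,2) y qc by (simp add: m_ac)
    then have "q [^] n \<otimes> y = inv u \<otimes> (c \<otimes> y)" using uc y qc by simp
    then have "q [^] n \<otimes> y \<in> V" using E(6) u cy by metis
    then show ?thesis by blast
  qed
  show "T = V \<or> T = carrier R"
  proof (cases "inv q \<in> T")
    case True
    have "y \<in> T" if y: "y \<in> carrier R" for y
    proof -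
      obtain n :: nat where n: "q [^] n \<otimes> y \<in> T" using den[OF y] T by blast
      have "inv q [^] n \<otimes> (q [^] n \<otimes> y) = (inv q \<otimes> q) [^] n \<otimes> y"
        using ic(1) qc y by (simp add: nat_pow_distrib m_assoc)
      also have "\<dots> = y" using ic y by simp
      finally show ?thesis using n pow_mem_subring[OF T(1) True, of n] subringE(6)[OF T(1)] by metis
    qed
    then show ?thesis using subringE(1)[OF T(1)] by blast
  next
    case False
    then show ?thesis using mx T by blast
  qed
qed

text \<open>Both elements would lie in the Jacobson radical of \<open>V\<close>, which is a proper ideal.\<close>

lemma avoids_inv_coprime:
  assumes V: "avoids_inv q V" "avoids_inv r V" and nz: "q \<noteq> \<zero>" "r \<noteq> \<zero>"
    and ab: "a \<in> V" "b \<in> V" "a \<otimes> q \<oplus> b \<otimes> r = \<one>"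
  shows False
proof -
  have sub: "subring V R" and qV: "q \<in> V" "r \<in> V" and nin: "inv q \<notin> V"
    using V unfolding avoids_inv_def by blast+
  note E = subringE[OF sub]
  have c: "q \<in> carrier R" "r \<in> carrier R" "a \<in> carrier R" "b \<in> carrier R"
    using qV ab E by auto
  have "\<one> \<ominus> r \<otimes> b = (a \<otimes> q \<oplus> b \<otimes> r) \<ominus> r \<otimes> b" using ab by simp
  also have "\<dots> = a \<otimes> q" using c by algebra
  finally have u: "a \<otimes> q \<noteq> \<zero>" "inv (a \<otimes> q) \<in> V"
    using avoids_inv_unit[OF V(2) nz(2) ab(2)] by auto
  have aq: "a \<otimes> q \<in> carrier R" using c by simp
  have "q \<otimes> (inv (a \<otimes> q) \<otimes> a) = inv (a \<otimes> q) \<otimes> (a \<otimes> q)"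
    using inv_carrier[OF aq u(1)] c by (simp add: m_ac)
  then have "q \<otimes> (inv (a \<otimes> q) \<otimes> a) = \<one>" using l_inv_nonzero[OF aq u(1)] by simp
  then have "inv q = inv (a \<otimes> q) \<otimes> a"
    using inv_unique_field c inv_carrier[OF aq u(1)] by simp
  then show False using nin u ab E(6) by metis
qed

end

section \<open>Fields with a transcendental element\<close>

text \<open>The finitely many coefficients of a relation over \<open>F\<close> generate a finite extension of \<open>K\<close>, over
  which \<open>x\<close> is algebraic; finite degrees multiply.\<close>

lemma (in field) algebraic_trans:
  assumes K: "subfield K R" and F: "subring F R"
    and KF: "\<And>y. y \<in> F \<Longrightarrow> (algebraic over K) y"
    and x: "x \<in> carrier R" "(algebraic over F) x"
  shows "(algebraic over K) x"
proof -
  obtain c l where l: "c \<in> F" "c \<noteq> \<zero>" "set l \<subseteq> F" "eval (c # l) x = \<zero>"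
    using algebraic_iff_leading[OF F x(1)] x(2) by blast
  let ?F = "finite_extension K (c # l)"
  have cl: "set (c # l) \<subseteq> F" using l by simp
  have clc: "set (c # l) \<subseteq> carrier R" using l subringE(1)[OF F] by auto
  have sf: "subfield ?F R" and fd: "finite_dimension K ?F"
    using finite_extension_is_subfield[OF K clc] finite_extension_finite_dimension[OF K clc] KF cl
    by blast+
  have "set (c # l) \<subseteq> ?F" by (rule finite_extension_mem[OF subfieldE(1)[OF K] clc])
  then have "(algebraic over ?F) x"
    using algebraic_iff_leading[OF subfieldE(1)[OF sf] x(1)] l(2,4) by auto
  then have fd2: "finite_dimension ?F (simple_extension ?F x)"
    using finite_dimension_simple_extension[OF sf x(1)] by blast
  have "finite_dimension K (simple_extension ?F x)"
    using telescopic_base[OF K sf] fd fd2 unfolding finite_dimension_def by blast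
  then show ?thesis
    using finite_dimension_imp_algebraic[OF K simple_extension_is_subring[OF subfieldE(1)[OF sf] x(1)]]
      simple_extension_mem[OF subfieldE(1)[OF sf] x(1)] by blast
qed

lemma (in ring) not_algebraic_iff: "\<not> (algebraic over K) x \<longleftrightarrow> (transcendental over K) x"
  by (simp add: over_def)

text \<open>A relation over the union of a chain has finitely many coefficients and so is a relation over a
  member of the chain; hence Zorn's lemma applies.\<close>

lemma (in domain) maximal_transcendental_subring:
  assumes A: "subring A R" and t: "t \<in> carrier R" "(transcendental over A) t"
  obtains D where "A \<subseteq> D" "subring D R" "(transcendental over D) t"
    "\<And>T. subring T R \<Longrightarrow> D \<subseteq> T \<Longrightarrow> (transcendental over T) t \<Longrightarrow> T = D"
proof -
  define \<A> where "\<A> = {S. subring S R \<and> A \<subseteq> S \<and> (transcendental over S) t}"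
  have "A \<in> \<A>" unfolding \<A>_def using A t by blast
  moreover have "\<Union>\<C> \<in> \<A>" if chain: "\<C> \<noteq> {}" "subset.chain \<A> \<C>" for \<C>
  proof -
    have sub: "\<C> \<subseteq> \<A>" and "subset.chain {S. subring S R} \<C>"
      using chain(2) by (auto simp: \<A>_def subset_chain_def)
    then have U: "subring (\<Union>\<C>) R" using subring_chain_Union[OF chain(1)] by blast
    have "(transcendental over (\<Union>\<C>)) t"
    proof (subst not_algebraic_iff[symmetric], rule notI)
      assume "(algebraic over (\<Union>\<C>)) t"
      then obtain l where l: "set l \<subseteq> \<Union>\<C>" "\<not> set l \<subseteq> {\<zero>}" "eval l t = \<zero>"
        using algebraic_iff_list[OF U t(1)] by blast
      obtain S where S: "S \<in> \<C>" "set l \<subseteq> S"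
        using finite_subset_Union_chain[OF _ l(1) chain] by blast
      then have "subring S R" "(transcendental over S) t" using sub unfolding \<A>_def by auto
      then show False using transcendental_list[of S t l] t(1) l S by blast
    qed
    moreover obtain S where "S \<in> \<C>" using chain(1) by blast
    moreover have "A \<subseteq> S" using sub \<open>S \<in> \<C>\<close> unfolding \<A>_def by auto
    ultimately show ?thesis unfolding \<A>_def using U by blast
  qed
  ultimately have "\<exists>M\<in>\<A>. \<forall>Y\<in>\<A>. M \<subseteq> Y \<longrightarrow> Y = M"
    by (intro subset_Zorn_nonempty) auto
  then obtain M where M: "M \<in> \<A>" "\<And>Y. Y \<in> \<A> \<Longrightarrow> M \<subseteq> Y \<Longrightarrow> Y = M" by metis
  then have "subring M R" "A \<subseteq> M" "(transcendental over M) t" unfolding \<A>_def by auto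
  moreover have "T = M" if "subring T R" "M \<subseteq> T" "(transcendental over T) t" for T
    using M(2)[of T] that calculation unfolding \<A>_def by auto
  ultimately show thesis using that by blast
qed

context field
begin

lemma transcendental_denominators:
  assumes D: "subring D R" and s: "s \<in> D" "s \<noteq> \<zero>"
    and t: "t \<in> carrier R" "(transcendental over D) t"
  shows "(transcendental over {x \<in> carrier R. \<exists>n::nat. s [^] n \<otimes> x \<in> D}) t"
    (is "(transcendental over ?D) t")
proof (subst not_algebraic_iff[symmetric], rule notI)
  note E = subringE[OF D]
  have sc: "s \<in> carrier R" using s E by blast
  assume "(algebraic over ?D) t"
  then obtain l where l: "set l \<subseteq> ?D" "\<not> set l \<subseteq> {\<zero>}" "eval l t = \<zero>"
    using algebraic_iff_list[OF subring_denominators[OF D s(1)] t(1)] by blast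
  have "\<exists>n::nat. \<forall>x\<in>set l. s [^] n \<otimes> x \<in> D"
    using l(1)
  proof (induction l)
    case (Cons a l)
    then obtain n m :: nat where nm: "\<forall>x\<in>set l. s [^] n \<otimes> x \<in> D" "s [^] m \<otimes> a \<in> D" by auto
    have c: "a \<in> carrier R" "set l \<subseteq> carrier R" using Cons.prems by auto
    have "s [^] (n + m) \<otimes> a = s [^] n \<otimes> (s [^] m \<otimes> a)"
      using sc c by (simp add: nat_pow_mult[symmetric] m_assoc)
    then have "s [^] (n + m) \<otimes> a \<in> D" using nm(2) pow_mem_subring[OF D s(1)] E(6) by simp
    moreover have "s [^] (n + m) \<otimes> x \<in> D" if x: "x \<in> set l" for x
    proof -
      have "s [^] (n + m) \<otimes> x = s [^] m \<otimes> (s [^] n \<otimes> x)"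
        using sc c x by (auto simp: nat_pow_mult[symmetric] m_ac)
      then show ?thesis using nm(1) x pow_mem_subring[OF D s(1)] E(6) by simp
    qed
    ultimately show ?case by auto
  qed simp
  then obtain n :: nat where n: "\<And>x. x \<in> set l \<Longrightarrow> s [^] n \<otimes> x \<in> D" by blast
  have lc: "set l \<subseteq> carrier R" using l(1) by blast
  have "eval (map (\<lambda>x. s [^] n \<otimes> x) l) t = s [^] n \<otimes> eval l t"
    using eval_map_mult[OF t(1), of "s [^] n" "\<lambda>x. x" l] sc lc by simp
  then have "eval (map (\<lambda>x. s [^] n \<otimes> x) l) t = \<zero>" using l(3) sc by simp
  moreover have "set (map (\<lambda>x. s [^] n \<otimes> x) l) \<subseteq> D" using n by auto
  ultimately have "set (map (\<lambda>x. s [^] n \<otimes> x) l) \<subseteq> {\<zero>}"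
    using transcendental_list[OF D t] by blast
  then have "s [^] n \<otimes> x = \<zero>" if "x \<in> set l" for x using that by auto
  then have "x = \<zero>" if "x \<in> set l" for x
    using that lc sc pow_nonzero[OF sc s(2), of n] integral[of "s [^] n" x] by blast
  then show False using l(2) by blast
qed

lemma inverse_in_denominators:
  assumes D: "subring D R" and s: "s \<in> D" "s \<noteq> \<zero>"
  shows "D \<subseteq> {x \<in> carrier R. \<exists>n::nat. s [^] n \<otimes> x \<in> D}"
    "inv s \<in> {x \<in> carrier R. \<exists>n::nat. s [^] n \<otimes> x \<in> D}"
proof -
  have sc: "s \<in> carrier R" using s subringE(1)[OF D] by blast
  show "D \<subseteq> {x \<in> carrier R. \<exists>n::nat. s [^] n \<otimes> x \<in> D}"
    using subringE(1)[OF D] by (auto intro!: exI[of _ "0::nat"])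
  show "inv s \<in> {x \<in> carrier R. \<exists>n::nat. s [^] n \<otimes> x \<in> D}"
    using inv_carrier[OF sc s(2)] r_inv_nonzero[OF sc s(2)] subringE(3)[OF D] sc
    by (auto intro!: exI[of _ "1::nat"])
qed

text \<open>Inverting elements of \<open>D\<close> only introduces denominators, which does not create relations for
  \<open>t\<close>; a subring maximal with \<open>t\<close> transcendental is therefore a field.\<close>

lemma maximal_transcendental_subfield:
  assumes A: "subring A R" and t: "t \<in> carrier R" "(transcendental over A) t"
  obtains D where "A \<subseteq> D" "subfield D R" "(transcendental over D) t"
    "\<And>T. subring T R \<Longrightarrow> D \<subseteq> T \<Longrightarrow> (transcendental over T) t \<Longrightarrow> T = D"
proof -
  obtain D where D: "A \<subseteq> D" "subring D R" and tr: "(transcendental over D) t"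
    and mx: "\<And>T. subring T R \<Longrightarrow> D \<subseteq> T \<Longrightarrow> (transcendental over T) t \<Longrightarrow> T = D"
    using maximal_transcendental_subring[OF A t] by blast
  have "inv c \<in> D" if "c \<in> D - {\<zero>}" for c
  proof -
    have c: "c \<in> D" "c \<noteq> \<zero>" using that by auto
    show ?thesis
      using mx[OF subring_denominators[OF D(2) c(1)] inverse_in_denominators(1)[OF D(2) c]
          transcendental_denominators[OF D(2) c t(1) tr]]
        inverse_in_denominators(2)[OF D(2) c] by blast
  qed
  then have "subfield D R" using subfieldI'[OF D(2)] by blast
  then show thesis using that D(1) tr mx by blast
qed

lemma eval_trailing_zeros:
  assumes "set l \<subseteq> carrier R" "q \<in> carrier R"
  shows "eval (l @ replicate n \<zero>) q = eval l q \<otimes> q [^] n"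
  using assms
proof (induction n)
  case 0
  then show ?case using eval_in_carrier by simp
next
  case (Suc n)
  have "eval ((l @ replicate n \<zero>) @ [\<zero>]) q = eval (l @ replicate n \<zero>) q \<otimes> q \<oplus> \<zero>"
    using Suc by (intro eval_append_aux) auto
  then show ?case using Suc eval_in_carrier[of l q]
    by (simp add: replicate_append_same m_assoc)
qed

text \<open>Enlarge the coefficient ring to a subring \<open>D\<close> that is maximal among those over which \<open>q\<close> is
  transcendental. Then \<open>D\<close> is a field and \<open>R\<close> is algebraic over \<open>D[q]\<close>, by exchange, while a
  nonzero element of \<open>D[q]\<close> is a power of \<open>q\<close> times a polynomial with nonzero constant term, and
  the latter is a unit wherever \<open>q\<close> is in the Jacobson radical.\<close>

lemma transcendental_imp_maximal_subring:
  assumes A: "subring A R" and q: "q \<in> carrier R" "(transcendental over A) q"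
  obtains V where "A \<subseteq> V" "avoids_inv q V" "maximal_subring V R"
proof -
  obtain D where D': "A \<subseteq> D" "subfield D R" and tr: "(transcendental over D) q"
    and mx: "\<And>T. subring T R \<Longrightarrow> D \<subseteq> T \<Longrightarrow> (transcendental over T) q \<Longrightarrow> T = D"
    using maximal_transcendental_subfield[OF A q] by blast
  have D: "A \<subseteq> D" "subring D R" using D' subfieldE(1) by auto
  note E = subringE[OF D(2)]
  let ?A = "simple_extension D q"
  have sA: "subring ?A R" by (rule simple_extension_is_subring[OF D(2) q(1)])
  have DA: "D \<subseteq> ?A" "q \<in> ?A"
    using simple_extension_incl[OF E(1) q(1)] simple_extension_mem[OF D(2) q(1)] by auto
  have q0: "q \<noteq> \<zero>"
  proof
    assume "q = \<zero>"
    then have "(algebraic over D) q" using zero_is_algebraic[OF D(2)] by simp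
    then show False using tr not_algebraic_iff by blast
  qed
  have ic: "inv q \<in> carrier R" "inv q \<otimes> q = \<one>"
    using inv_carrier[OF q(1) q0] l_inv_nonzero[OF q(1) q0] by auto
  have invD: "inv c \<in> D" if "c \<in> D" "c \<noteq> \<zero>" for c
    using subfield_m_inv(1)[OF D'(2), of c] that by blast
  have alg: "(algebraic over ?A) y" if y: "y \<in> carrier R" for y
  proof (cases "y \<in> D")
    case True
    then show ?thesis using algebraic_self[OF sA] DA by blast
  next
    case False
    have sub: "subring (simple_extension D y) R" by (rule simple_extension_is_subring[OF D(2) y])
    have "D \<subseteq> simple_extension D y" "y \<in> simple_extension D y"
      using simple_extension_incl[OF E(1) y] simple_extension_mem[OF D(2) y] by auto
    then have "(algebraic over (simple_extension D y)) q"
      using mx[OF sub] False not_algebraic_iff by blast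
    then show ?thesis using algebraic_exchange[OF D(2) q(1) y _ tr] by blast
  qed
  have "inv q \<notin> ?A"
  proof
    assume "inv q \<in> ?A"
    then obtain l where l: "set l \<subseteq> D" "inv q = eval l q"
      using mem_simple_extension_iff[OF E(1) q(1)] by blast
    have lc: "set l \<subseteq> carrier R" using l E by blast
    have "eval (l @ [\<ominus> \<one>]) q = eval l q \<otimes> q \<oplus> \<ominus> \<one>"
      using lc q by (intro eval_append_aux) auto
    also have "\<dots> = \<zero>" using l(2)[symmetric] ic by (simp add: r_neg)
    finally have "set (l @ [\<ominus> \<one>]) \<subseteq> {\<zero>}"
      using l(1) E by (intro transcendental_list[OF D(2) q(1) tr]) auto
    then have "\<ominus> \<one> = \<zero>" by simp
    then have "\<one> = \<zero>" by (metis minus_minus minus_zero one_closed)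
    then show False by simp
  qed
  then obtain V where V: "?A \<subseteq> V" "avoids_inv q V"
    using avoids_inv_exists[OF sA DA(2)] by blast
  then have sV: "subring V R" and qV: "q \<in> V" unfolding avoids_inv_def by blast+
  note F = subringE[OF sV]
  have "maximal_subring V R"
  proof (rule avoids_inv_imp_maximal_subring[OF V(2) q0 sA V(1) alg])
    fix a assume a: "a \<in> ?A" "a \<noteq> \<zero>"
    then obtain l where l: "set l \<subseteq> D" "a = eval l q"
      using mem_simple_extension_iff[OF E(1) q(1)] by blast
    have "\<not> set (rev l) \<subseteq> {\<zero>}" using eval_zeros[OF q(1), of l] l a by auto
    then obtain n c l' where "rev l = replicate n \<zero> @ c # l'" and c: "c \<noteq> \<zero>"
      by (rule nontrivial_list_split_first)
    then have "l = rev (replicate n \<zero> @ c # l')" by (metis rev_rev_ident)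
    then have ls: "l = (rev l' @ [c]) @ replicate n \<zero>" by simp
    then have cD: "c \<in> D" "set l' \<subseteq> D" using l(1) by auto
    have cc: "c \<in> carrier R" "set (rev l') \<subseteq> carrier R" using cD E by auto
    define b where "b = eval (rev l') q"
    have bV: "b \<in> V"
      unfolding b_def using eval_mem_subring[OF sV _ qV, of "rev l'"] cD DA V by auto
    have icV: "c \<in> V" "inv c \<in> V" using invD[OF cD(1) c] cD DA V by auto
    have car: "b \<in> carrier R" "inv c \<in> carrier R" "c \<otimes> inv c = \<one>"
      using bV icV F r_inv_nonzero[OF cc(1) c] by auto
    \<comment> \<open>\<open>a\<close> is a power of \<open>q\<close> times \<open>?u\<close>, and \<open>?u\<close> is the unit \<open>c\<close> of \<open>D\<close> times \<open>?s\<close>, which is \<open>1\<close> modulo \<open>q\<close>\<close>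
    let ?u = "b \<otimes> q \<oplus> c"
    let ?s = "\<one> \<ominus> q \<otimes> (\<ominus> (inv c) \<otimes> b)"
    have "\<ominus> (inv c) \<otimes> b \<in> V" using icV bV F by auto
    then have s: "?s \<noteq> \<zero>" "inv ?s \<in> V" using avoids_inv_unit[OF V(2) q0] by blast+
    have sc: "?s \<in> carrier R" using car q by simp
    have us: "?u = c \<otimes> ?s"
    proof -
      have "c \<otimes> ?s = c \<oplus> (c \<otimes> inv c) \<otimes> (b \<otimes> q)"
        using car(1,2) cc q by algebra
      then show ?thesis using car cc q by (simp add: a_comm)
    qed
    have "a = ?u \<otimes> q [^] n"
      unfolding l(2) ls b_def using eval_trailing_zeros[of "rev l' @ [c]" q n] cc q
        eval_append_aux[of "rev l'" c q] by auto
    then have aq: "a = q [^] n \<otimes> ?u" using car cc q by (simp add: m_comm)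
    have u0: "?u \<noteq> \<zero>" using us integral_iff s c sc cc by simp
    have ucar: "?u \<in> carrier R" using car cc q by simp
    have isc: "inv ?s \<in> carrier R" using s F by blast
    have swap: "(c \<otimes> x) \<otimes> (inv c \<otimes> y) = (c \<otimes> inv c) \<otimes> (x \<otimes> y)"
      if "x \<in> carrier R" "y \<in> carrier R" for x y
      using that cc car(2) by (simp add: m_ac)
    have "?u \<otimes> (inv c \<otimes> inv ?s) = (c \<otimes> inv c) \<otimes> (?s \<otimes> inv ?s)"
      unfolding us by (rule swap[OF sc isc])
    then have "?u \<otimes> (inv c \<otimes> inv ?s) = \<one>" using car r_inv_nonzero[OF sc s(1)] by simp
    then have "inv ?u = inv c \<otimes> inv ?s" using inv_unique_field[OF ucar] car isc by simp
    then have "inv ?u \<in> V" using icV s F by auto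
    moreover have "?u \<in> V" using bV qV icV F by auto
    ultimately show "\<exists>n::nat. \<exists>u\<in>V. a = q [^] n \<otimes> u \<and> u \<noteq> \<zero> \<and> inv u \<in> V"
      using aq u0 by blast
  qed
  moreover have "A \<subseteq> V" using D DA V by blast
  ultimately show thesis using that V(2) by blast
qed

text \<open>Sylvester's recursion: every term is \<open>1\<close> modulo each earlier one, and is integral over the
  ring generated by each later one.\<close>

primrec sylvester :: "'a \<Rightarrow> nat \<Rightarrow> 'a" where
  "sylvester t 0 = t"
| "sylvester t (Suc n) = sylvester t n \<otimes> (sylvester t n \<ominus> \<one>) \<oplus> \<one>"

lemma sylvester_closed: "t \<in> carrier R \<Longrightarrow> sylvester t n \<in> carrier R"
  by (induction n) auto

lemma sylvester_integral:
  assumes t: "t \<in> carrier R"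
  shows "eval (\<one> # [\<ominus> \<one>, \<one> \<ominus> sylvester t (Suc n)]) (sylvester t n) = \<zero>"
proof -
  have s: "sylvester t n \<in> carrier R" by (rule sylvester_closed[OF t])
  have "\<one> \<otimes> (sylvester t n \<otimes> sylvester t n) \<oplus> (\<ominus> \<one> \<otimes> sylvester t n
      \<oplus> ((\<one> \<ominus> (sylvester t n \<otimes> (sylvester t n \<ominus> \<one>) \<oplus> \<one>)) \<otimes> \<one> \<oplus> \<zero>)) = \<zero>"
    using s by algebra
  then show ?thesis using s by (simp add: numeral_2_eq_2)
qed

text \<open>Each term satisfies a quadratic equation over the ring generated by its successor, so an
  algebraic successor would make it algebraic.\<close>

lemma sylvester_transcendental:
  assumes D: "subfield D R" and t: "t \<in> carrier R" "(transcendental over D) t"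
  shows "(transcendental over D) (sylvester t n)"
proof (induction n)
  case 0
  then show ?case using t by simp
next
  case (Suc n)
  note s = sylvester_closed[OF t(1)]
  show ?case
  proof (subst not_algebraic_iff[symmetric], rule notI)
    assume a: "(algebraic over D) (sylvester t (Suc n))"
    let ?K = "simple_extension D (sylvester t (Suc n))"
    have sK: "subring ?K R" by (rule simple_extension_is_subring[OF subfieldE(1)[OF D] s])
    note E = subringE[OF sK]
    have "sylvester t (Suc n) \<in> ?K" by (rule simple_extension_mem[OF subfieldE(1)[OF D] s])
    then have mem: "set [\<ominus> \<one>, \<one> \<ominus> sylvester t (Suc n)] \<subseteq> ?K"
      using E(3,5,7) by (simp add: a_minus_def del: sylvester.simps)
    have "(algebraic over ?K) (sylvester t n)"
      using algebraic_iff_leading[OF sK s, of n] sylvester_integral[OF t(1), of n] mem E(3)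
      by (metis zero_not_one)
    moreover have "(algebraic over D) y" if "y \<in> ?K" for y
      using simple_extesion_mem_imp_algebraic[OF D s a that] .
    ultimately have "(algebraic over D) (sylvester t n)"
      using algebraic_trans[OF D sK _ s] by blast
    then show False using Suc not_algebraic_iff by blast
  qed
qed

lemma sylvester_cong_one:
  assumes V: "subring V R" and t: "t \<in> carrier R"
    and mem: "\<And>j. i \<le> j \<Longrightarrow> j \<le> n \<Longrightarrow> sylvester t j \<in> V" and "i < n"
  shows "\<exists>w\<in>V. sylvester t n = \<one> \<oplus> w \<otimes> sylvester t i"
proof -
  note E = subringE[OF V]
  note s = sylvester_closed[OF t]
  have "m \<le> n \<Longrightarrow> \<exists>w\<in>V. sylvester t m = \<one> \<oplus> w \<otimes> sylvester t i" if "Suc i \<le> m" for m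
    using that
  proof (induction m rule: dec_induct)
    case base
    have "sylvester t i \<ominus> \<one> \<in> V" using mem[of i] \<open>i < n\<close> E by (simp add: a_minus_def)
    moreover have "sylvester t (Suc i) = \<one> \<oplus> (sylvester t i \<ominus> \<one>) \<otimes> sylvester t i"
      using s[of i] by (simp add: a_comm m_comm)
    ultimately show ?case by blast
  next
    case (step m)
    then obtain w where w: "w \<in> V" "sylvester t m = \<one> \<oplus> w \<otimes> sylvester t i" by auto
    have m: "sylvester t m \<in> V" using mem[of m] step by simp
    have wc: "w \<in> carrier R" using w E by blast
    have "sylvester t m \<ominus> \<one> = w \<otimes> sylvester t i"
      unfolding w(2) using wc s[of i] by algebra
    then have "sylvester t (Suc m) = sylvester t m \<otimes> (w \<otimes> sylvester t i) \<oplus> \<one>" by simp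
    also have "\<dots> = \<one> \<oplus> (sylvester t m \<otimes> w) \<otimes> sylvester t i"
      using wc s by (simp add: a_comm m_assoc)
    finally show ?case using m w E(6) by blast
  qed
  then show ?thesis using \<open>i < n\<close> by simp
qed

text \<open>The \<open>n\<close>-th Sylvester term \<open>s n\<close> yields a maximal subring \<open>V n\<close> in which it is not invertible. Being
  integrally closed, \<open>V n\<close> contains all earlier terms, and \<open>s n\<close> is \<open>1\<close> modulo each of them; so an
  earlier term and \<open>s n\<close> cannot both be nonunits of \<open>V n\<close>.\<close>

lemma transcendental_imp_infinite_maximal_subrings:
  assumes A: "subring A R" and t: "t \<in> carrier R" "(transcendental over A) t"
  shows "infinite {S. maximal_subring S R}"
proof -
  obtain D where sf: "subfield D R" and tr: "(transcendental over D) t"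
    using maximal_transcendental_subfield[OF A t] by blast
  have D: "subring D R" by (rule subfieldE(1)[OF sf])
  note s = sylvester_closed[OF t(1)]
  have tr': "(transcendental over D) (sylvester t n)" for n
    by (rule sylvester_transcendental[OF sf t(1) tr])
  have "\<exists>V. avoids_inv (sylvester t n) V \<and> maximal_subring V R" for n
    using transcendental_imp_maximal_subring[OF D s tr'] by metis
  then obtain V where V: "\<And>n. avoids_inv (sylvester t n) (V n)" "\<And>n. maximal_subring (V n) R"
    by metis
  have nz: "sylvester t n \<noteq> \<zero>" for n
    using tr'[of n] zero_is_algebraic[OF D] not_algebraic_iff by metis
  have low: "sylvester t j \<in> V n" if "j \<le> n" for j n
    using that
  proof (induction j rule: inc_induct)
    case base
    then show ?case using V(1) unfolding avoids_inv_def by blast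
  next
    case (step m)
    have E: "subring (V n) R" using V(1) unfolding avoids_inv_def by blast
    have "set [\<ominus> \<one>, \<one> \<ominus> sylvester t (Suc m)] \<subseteq> V n"
      using step subringE(3,5,7)[OF E] by (simp add: a_minus_def del: sylvester.simps)
    then show ?case
      using avoids_inv_integrally_closed[OF V(1) nz s _ sylvester_integral[OF t(1)]] by blast
  qed
  have ne: "V i \<noteq> V n" if lt: "i < n" for i n
  proof
    assume e: "V i = V n"
    have E: "subring (V n) R" using V(1) unfolding avoids_inv_def by blast
    obtain w where w: "w \<in> V n" "sylvester t n = \<one> \<oplus> w \<otimes> sylvester t i"
      using sylvester_cong_one[OF E t(1) low lt] by blast
    have wc: "w \<in> carrier R" using w subringE(1)[OF E] by blast
    have eq: "\<ominus> w \<otimes> sylvester t i \<oplus> \<one> \<otimes> sylvester t n = \<one>"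
      unfolding w(2) using wc s[of i] by algebra
    show False
      by (rule avoids_inv_coprime[OF _ V(1)[of n] nz[of i] nz[of n] _ _ eq])
        (use V(1)[of i] e w(1) subringE(3,5)[OF E] in auto)
  qed
  have "inj V"
    by (rule linorder_injI) (use ne in auto)
  then have "infinite (range V)" by (rule range_inj_infinite)
  moreover have "range V \<subseteq> {S. maximal_subring S R}" using V(2) by blast
  ultimately show ?thesis by (rule infinite_super[rotated])
qed

end

section \<open>Fields of characteristic zero\<close>

definition (in ring) prime_subring :: "'a set" where
  "prime_subring = {[k] \<cdot> \<one> | k::int. True}"

context ring
begin

lemma int_one_add: "[(j + k :: int)] \<cdot> \<one> = [j] \<cdot> \<one> \<oplus> [k] \<cdot> \<one>"
  using add.int_pow_mult[of \<one> j k] by simp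

lemma int_one_neg: "[(- k :: int)] \<cdot> \<one> = \<ominus> ([k] \<cdot> \<one>)"
  using add.int_pow_neg[of \<one> k] by simp

lemma int_one_zero: "[(0 :: int)] \<cdot> \<one> = \<zero>"
  by (simp add: add_pow_int_ge)

lemma int_one_one: "[(1 :: int)] \<cdot> \<one> = \<one>"
  using add.int_pow_1[of \<one>] by simp

lemma int_one_mult: "[(j * k :: int)] \<cdot> \<one> = [j] \<cdot> \<one> \<otimes> [k] \<cdot> \<one>"
proof -
  have "[j] \<cdot> \<one> \<otimes> [k] \<cdot> \<one> = [j] \<cdot> (\<one> \<otimes> [k] \<cdot> \<one>)"
    by (rule add_pow_ldistr_int) auto
  also have "\<dots> = [(k * j)] \<cdot> \<one>"
    using add.int_pow_pow[of \<one> j k] by simp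
  finally show ?thesis by (simp add: mult.commute)
qed

lemma int_one_power: "[(k ^ n :: int)] \<cdot> \<one> = ([k] \<cdot> \<one>) [^] n"
  by (induction n) (simp_all add: int_one_one int_one_mult power_Suc2 del: power_Suc)

lemma int_one_mem: "subring S R \<Longrightarrow> [(k::int)] \<cdot> \<one> \<in> S"
proof -
  assume S: "subring S R"
  note E = subringE[OF S]
  have "[(int n)] \<cdot> \<one> \<in> S" for n
    by (induction n) (use E in \<open>simp_all add: int_one_add int_one_one int_one_zero\<close>)
  then show ?thesis
    by (cases k rule: int_cases2) (use E(5) int_one_neg in auto)
qed

lemma prime_subring_subset: "subring S R \<Longrightarrow> prime_subring \<subseteq> S"
  using int_one_mem unfolding prime_subring_def by blast

lemma prime_subring_is_subring: "subring prime_subring R"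
proof (rule subringI)
  show "prime_subring \<subseteq> carrier R" unfolding prime_subring_def by auto
  show "\<one> \<in> prime_subring" unfolding prime_subring_def using int_one_one by (metis (mono_tags) mem_Collect_eq)
  show "\<ominus> h \<in> prime_subring" if "h \<in> prime_subring" for h
    using that int_one_neg unfolding prime_subring_def by (auto simp: int_one_neg[symmetric])
  show "h1 \<otimes> h2 \<in> prime_subring" "h1 \<oplus> h2 \<in> prime_subring"
    if "h1 \<in> prime_subring" "h2 \<in> prime_subring" for h1 h2
    using that unfolding prime_subring_def
    by (auto simp: int_one_mult[symmetric] int_one_add[symmetric])
qed

end

context field
begin

text \<open>For each prime \<open>p\<close> there is a maximal subring in which \<open>p\<close> is not invertible, because an
  integer prime to \<open>p\<close> is invertible wherever \<open>p\<close> is in the Jacobson radical. No maximal subring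
  serves two primes, by Bezout.\<close>

lemma char_zero_imp_infinite_maximal_subrings:
  assumes char: "\<And>k::int. [k] \<cdot> \<one> = \<zero> \<Longrightarrow> k = 0"
    and alg: "\<And>y. y \<in> carrier R \<Longrightarrow> (algebraic over prime_subring) y"
  shows "infinite {S. maximal_subring S R}"
proof -
  define \<iota> where "\<iota> k = [(k::int)] \<cdot> \<one>" for k
  note P = prime_subring_is_subring
  have hom: "\<iota> (j * k) = \<iota> j \<otimes> \<iota> k" "\<iota> (j + k) = \<iota> j \<oplus> \<iota> k" "\<iota> 1 = \<one>"
    "\<iota> (- k) = \<ominus> \<iota> k" "\<iota> k \<in> carrier R" "\<iota> (k ^ n) = \<iota> k [^] n" for j k n
    unfolding \<iota>_def by (auto simp: int_one_mult int_one_add int_one_one int_one_neg int_one_power)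
  have inj: "\<iota> k = \<zero> \<Longrightarrow> k = 0" for k unfolding \<iota>_def by (rule char)
  have bez: "\<exists>a b. \<iota> a \<otimes> \<iota> j \<oplus> \<iota> b \<otimes> \<iota> k = \<one>" if "coprime j k" for j k
  proof -
    obtain a b where "a * j + b * k = gcd j k" using bezout_int[of j k] by blast
    then have "a * j + b * k = 1" using that by simp
    then have "\<iota> (a * j + b * k) = \<one>" using hom(3) by simp
    then show ?thesis unfolding hom(1,2) by blast
  qed
  have ex: "\<exists>V. avoids_inv (\<iota> (int p)) V \<and> maximal_subring V R" if p: "Factorial_Ring.prime p" for p :: nat
  proof -
    have p0: "\<iota> (int p) \<noteq> \<zero>" using inj[of "int p"] p by auto
    have pP: "\<iota> k \<in> prime_subring" for k
      unfolding \<iota>_def prime_subring_def by blast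
    have "inv (\<iota> (int p)) \<notin> prime_subring"
    proof
      assume "inv (\<iota> (int p)) \<in> prime_subring"
      then obtain k where "inv (\<iota> (int p)) = \<iota> k" unfolding prime_subring_def \<iota>_def by blast
      then have "\<iota> (int p * k) = \<iota> 1"
        using r_inv_nonzero[OF hom(5) p0] unfolding hom(1,3) by simp
      then have "\<iota> (int p * k + - 1) = \<iota> 1 \<oplus> \<ominus> \<iota> 1" by (simp only: hom(2,4))
      then have "\<iota> (int p * k + - 1) = \<zero>" using hom(5)[of 1] by (simp add: r_neg)
      then have "int p * k + - 1 = 0" by (rule inj)
      then have "int p dvd 1" by (intro dvdI[of _ _ k]) simp
      then show False using p by auto
    qed
    then obtain V where V: "prime_subring \<subseteq> V" "avoids_inv (\<iota> (int p)) V"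
      using avoids_inv_exists[OF P pP] by blast
    then have sV: "subring V R" unfolding avoids_inv_def by blast
    have mV: "\<iota> k \<in> V" for k using pP V by blast
    have "maximal_subring V R"
    proof (rule avoids_inv_imp_maximal_subring[OF V(2) p0 P V(1) alg])
      fix a assume "a \<in> prime_subring" "a \<noteq> \<zero>"
      then obtain k where a: "a = \<iota> k" unfolding prime_subring_def \<iota>_def by blast
      then have k: "k \<noteq> 0" using \<open>a \<noteq> \<zero>\<close> int_one_zero unfolding \<iota>_def by auto
      have pp: "prime_elem (int p)" using p by simp
      obtain k' where k': "k = int p ^ multiplicity (int p) k * k'" "\<not> int p dvd k'"
        using multiplicity_decompose'[OF k, of "int p"] prime_elem_not_unit[OF pp] by blast
      then have "coprime k' (int p)"
        using prime_elem_imp_coprime[OF pp, of k'] by (simp add: coprime_commute)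
      then obtain x y where xy: "\<iota> x \<otimes> \<iota> k' \<oplus> \<iota> y \<otimes> \<iota> (int p) = \<one>" using bez by blast
      have k'0: "\<iota> k' \<noteq> \<zero>" using inj k'(2) by auto
      let ?s = "\<one> \<ominus> \<iota> (int p) \<otimes> \<iota> y"
      have s: "?s \<noteq> \<zero>" "inv ?s \<in> V" using avoids_inv_unit[OF V(2) p0 mV] by auto
      have sc: "?s \<in> carrier R" "inv ?s \<in> carrier R" using hom(5) s(2) subringE(1)[OF sV] by auto
      have "?s = (\<iota> x \<otimes> \<iota> k' \<oplus> \<iota> y \<otimes> \<iota> (int p)) \<ominus> \<iota> (int p) \<otimes> \<iota> y" unfolding xy by simp
      also have "\<dots> = \<iota> k' \<otimes> \<iota> x"
        using hom(5)[of x] hom(5)[of k'] hom(5)[of y] hom(5)[of "int p"] by algebra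
      finally have skx: "?s = \<iota> k' \<otimes> \<iota> x" .
      have "\<iota> k' \<otimes> (\<iota> x \<otimes> inv ?s) = (\<iota> k' \<otimes> \<iota> x) \<otimes> inv ?s"
        by (rule m_assoc[symmetric, OF hom(5) hom(5) sc(2)])
      also have "\<dots> = ?s \<otimes> inv ?s" by (simp only: skx)
      finally have "\<iota> k' \<otimes> (\<iota> x \<otimes> inv ?s) = ?s \<otimes> inv ?s" .
      then have "\<iota> k' \<otimes> (\<iota> x \<otimes> inv ?s) = \<one>" using r_inv_nonzero[OF sc(1) s(1)] by simp
      then have "inv (\<iota> k') = \<iota> x \<otimes> inv ?s"
        by (rule inv_unique_field[OF hom(5) m_closed[OF hom(5) sc(2)]])
      then have "inv (\<iota> k') \<in> V" using mV s(2) subringE(6)[OF sV] by simp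
      moreover have "a = \<iota> (int p) [^] multiplicity (int p) k \<otimes> \<iota> k'"
        unfolding a hom(6)[symmetric] hom(1)[symmetric] using arg_cong[OF k'(1), of \<iota>] .
      ultimately show "\<exists>n::nat. \<exists>u\<in>V. a = \<iota> (int p) [^] n \<otimes> u \<and> u \<noteq> \<zero> \<and> inv u \<in> V"
        using mV k'0 by blast
    qed
    then show ?thesis using V by blast
  qed
  then obtain V where V: "\<And>p::nat. Factorial_Ring.prime p \<Longrightarrow> avoids_inv (\<iota> (int p)) (V p)"
    "\<And>p::nat. Factorial_Ring.prime p \<Longrightarrow> maximal_subring (V p) R"
    by metis
  have "inj_on V {p::nat. Factorial_Ring.prime p}"
  proof (rule inj_onI, rule ccontr)
    fix p q :: nat
    assume pq: "p \<in> {p. Factorial_Ring.prime p}" "q \<in> {p. Factorial_Ring.prime p}" "V p = V q" "p \<noteq> q"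
    then have "coprime p q" using primes_coprime by blast
    then obtain a b where ab: "\<iota> a \<otimes> \<iota> (int p) \<oplus> \<iota> b \<otimes> \<iota> (int q) = \<one>"
      using bez[of "int p" "int q"] by auto
    have "subring (V p) R" using V(1)[of p] pq unfolding avoids_inv_def by blast
    then have mem: "\<iota> k \<in> V p" for k unfolding \<iota>_def by (rule int_one_mem)
    have nz: "\<iota> (int p) \<noteq> \<zero>" "\<iota> (int q) \<noteq> \<zero>" using inj[of "int p"] inj[of "int q"] pq by auto
    show False
      using avoids_inv_coprime[of "\<iota> (int p)" "V p" "\<iota> (int q)"] V(1)[of p] V(1)[of q] pq nz mem ab by auto
  qed
  then have "infinite (V ` {p::nat. Factorial_Ring.prime p})"
    using primes_infinite finite_imageD by blast
  moreover have "V ` {p::nat. Factorial_Ring.prime p} \<subseteq> {S. maximal_subring S R}" using V(2) by blast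
  ultimately show ?thesis by (rule infinite_super[rotated])
qed

text \<open>Neither a transcendental element nor characteristic zero is compatible with finitely many maximal
  subrings, so some positive multiple of \<open>1\<close> vanishes; the least such is prime because \<open>R\<close> is a
  domain.\<close>

lemma finite_maximal_subrings_imp_algebraic:
  assumes fin: "finite {S. maximal_subring S R}"
  obtains p :: nat where "Factorial_Ring.prime p" "[(int p)] \<cdot> \<one> = \<zero>"
    "\<And>x. x \<in> carrier R \<Longrightarrow> (algebraic over prime_subring) x"
proof -
  have alg: "(algebraic over prime_subring) x" if "x \<in> carrier R" for x
    using transcendental_imp_infinite_maximal_subrings[OF prime_subring_is_subring that] fin
      not_algebraic_iff by blast
  then have "\<not> (\<forall>k::int. [k] \<cdot> \<one> = \<zero> \<longrightarrow> k = 0)"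
    using char_zero_imp_infinite_maximal_subrings fin by blast
  then obtain k :: int where k: "[k] \<cdot> \<one> = \<zero>" "k \<noteq> 0" by blast
  have "[\<bar>k\<bar>] \<cdot> \<one> = \<zero>" using k int_one_neg[of k] by (auto simp: abs_if)
  then have ex: "\<exists>n>0. [(int n)] \<cdot> \<one> = \<zero>" using k by (intro exI[of _ "nat \<bar>k\<bar>"]) auto
  define p where "p = (LEAST n. 0 < n \<and> [(int n)] \<cdot> \<one> = \<zero>)"
  have p: "0 < p" "[(int p)] \<cdot> \<one> = \<zero>"
    using LeastI_ex[OF ex] unfolding p_def by auto
  have least: "[(int n)] \<cdot> \<one> \<noteq> \<zero>" if "0 < n" "n < p" for n
    using not_less_Least[of n "\<lambda>n. 0 < n \<and> [(int n)] \<cdot> \<one> = \<zero>"] that unfolding p_def by auto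
  have "Factorial_Ring.prime p"
    unfolding prime_nat_iff
  proof (intro conjI allI impI)
    have "p \<noteq> 1" using p(2) int_one_one by auto
    then show "1 < p" using p(1) by simp
    fix m assume "m dvd p"
    then obtain k where mk: "p = m * k" by blast
    then have "[(int m)] \<cdot> \<one> \<otimes> [(int k)] \<cdot> \<one> = \<zero>"
      using p(2) int_one_mult[of "int m" "int k"] by simp
    then have "[(int m)] \<cdot> \<one> = \<zero> \<or> [(int k)] \<cdot> \<one> = \<zero>"
      by (rule integral) auto
    moreover have "0 < m" "0 < k" using mk p(1) by auto
    ultimately have "\<not> m < p \<or> \<not> k < p" using least by blast
    then show "m = 1 \<or> m = p" using mk \<open>0 < m\<close> \<open>0 < k\<close> by auto
  qed
  then show thesis using that p(2) alg by blast
qed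

end

section \<open>The Frobenius map and orders of finite subfields\<close>

context cring
begin

lemma binomial_cring:
  assumes x: "x \<in> carrier R" and y: "y \<in> carrier R"
  shows "(x \<oplus> y) [^] (n::nat) = (\<Oplus>k\<in>{..n}. [(n choose k)] \<cdot> (x [^] k \<otimes> y [^] (n - k)))"
proof (induction n)
  case 0
  then show ?case using x y by simp
next
  case (Suc n)
  define T where "T k = [(n choose k)] \<cdot> (x [^] k \<otimes> y [^] (n - k))" for k
  define U where "U k = [(n choose k)] \<cdot> (x [^] k \<otimes> y [^] (Suc n - k))" for k
  have car: "T k \<in> carrier R" "U k \<in> carrier R" for k unfolding T_def U_def using x y by auto
  have yT: "y \<otimes> T k = U k" if "k \<le> n" for k
    unfolding T_def U_def using x y that
    by (simp add: add_pow_rdistr Suc_diff_le m_ac)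
  have xT: "x \<otimes> T k = [(n choose k)] \<cdot> (x [^] Suc k \<otimes> y [^] (n - k))" for k
    unfolding T_def using x y by (simp add: add_pow_rdistr m_ac)
  have pascal: "[(Suc n choose Suc k)] \<cdot> (x [^] Suc k \<otimes> y [^] (Suc n - Suc k)) = x \<otimes> T k \<oplus> U (Suc k)" for k
    unfolding xT U_def using x y add.nat_pow_mult[of "x [^] Suc k \<otimes> y [^] (n - k)" "n choose k" "n choose Suc k"]
    by simp
  have xsum: "x \<otimes> (\<Oplus>k\<in>{..n}. T k) = (\<Oplus>k\<in>{..n}. x \<otimes> T k)"
    using x car by (intro finsum_rdistr) auto
  have "y \<otimes> (\<Oplus>k\<in>{..n}. T k) = (\<Oplus>k\<in>{..n}. y \<otimes> T k)"
    using y car by (intro finsum_rdistr) auto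
  also have "\<dots> = (\<Oplus>k\<in>{..n}. U k)"
    using car x y yT by (intro finsum_cong') auto
  also have "\<dots> = (\<Oplus>k\<in>{..Suc n}. U k)"
  proof -
    have "U (Suc n) = \<zero>" unfolding U_def by (simp add: binomial_eq_0)
    then show ?thesis using finsum_Suc[of U n] car by (simp add: Pi_def)
  qed
  also have "\<dots> = (\<Oplus>k\<in>{..n}. U (Suc k)) \<oplus> U 0"
    using car by (intro finsum_Suc2) auto
  finally have ysum: "y \<otimes> (\<Oplus>k\<in>{..n}. T k) = (\<Oplus>k\<in>{..n}. U (Suc k)) \<oplus> U 0" .
  define W where "W k = [(Suc n choose k)] \<cdot> (x [^] k \<otimes> y [^] (Suc n - k))" for k
  have Wc: "W k \<in> carrier R" for k unfolding W_def using x y by auto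
  have "(\<Oplus>k\<in>{..Suc n}. W k) = (\<Oplus>k\<in>{..n}. W (Suc k)) \<oplus> W 0"
    using Wc by (intro finsum_Suc2) auto
  moreover have "W (Suc k) = x \<otimes> T k \<oplus> U (Suc k)" for k
    unfolding W_def by (rule pascal)
  moreover have "W 0 = U 0" unfolding W_def U_def by simp
  moreover have "(\<Oplus>k\<in>{..n}. x \<otimes> T k \<oplus> U (Suc k))
      = (\<Oplus>k\<in>{..n}. x \<otimes> T k) \<oplus> (\<Oplus>k\<in>{..n}. U (Suc k))"
    using car x by (intro finsum_addf) auto
  ultimately have W: "(\<Oplus>k\<in>{..Suc n}. W k)
      = ((\<Oplus>k\<in>{..n}. x \<otimes> T k) \<oplus> (\<Oplus>k\<in>{..n}. U (Suc k))) \<oplus> U 0"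
    by (simp only:)
  have "(x \<oplus> y) [^] Suc n = (\<Oplus>k\<in>{..n}. T k) \<otimes> (x \<oplus> y)"
    unfolding nat_pow_Suc Suc T_def ..
  also have "\<dots> = x \<otimes> (\<Oplus>k\<in>{..n}. T k) \<oplus> y \<otimes> (\<Oplus>k\<in>{..n}. T k)"
    using x y finsum_closed[of T "{..n}"] car by (simp add: Pi_def r_distr m_comm[of _ x] m_comm[of _ y])
  also have "\<dots> = (\<Oplus>k\<in>{..Suc n}. W k)"
    unfolding W xsum ysum using car x by (intro a_assoc[symmetric] finsum_closed) auto
  finally show ?case unfolding W_def .
qed

lemma frobenius_add:
  assumes p: "Factorial_Ring.prime p" "[(int p)] \<cdot> \<one> = \<zero>"
    and x: "x \<in> carrier R" and y: "y \<in> carrier R"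
  shows "(x \<oplus> y) [^] p = x [^] p \<oplus> y [^] p"
proof -
  define T where "T k = [(p choose k)] \<cdot> (x [^] k \<otimes> y [^] (p - k))" for k
  have car: "T k \<in> carrier R" for k unfolding T_def using x y by auto
  have "2 \<le> p" using p(1) by (rule prime_ge_2_nat)
  then obtain m where m: "p = Suc (Suc m)" by (metis add_2_eq_Suc le_Suc_ex)
  have "T k = \<zero>" if "0 < k" "k < p" for k
  proof -
    let ?z = "x [^] k \<otimes> y [^] (p - k)"
    have z: "?z \<in> carrier R" using x y by simp
    have "p dvd (p choose k)" using dvd_choose_prime[of k p] that p(1) by simp
    then obtain c where c: "p choose k = p * c" by (rule dvdE)
    have "T k = [(int p * int c)] \<cdot> ?z" unfolding T_def c by (simp add: add_pow_int_ge nat_mult_distrib)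
    also have "\<dots> = [(int p * int c)] \<cdot> (\<one> \<otimes> ?z)" using z by simp
    also have "\<dots> = [(int p * int c)] \<cdot> \<one> \<otimes> ?z" using z by (intro add_pow_ldistr_int[symmetric]) auto
    also have "\<dots> = \<zero>" using z p(2) by (simp add: int_one_mult)
    finally show ?thesis .
  qed
  then have mid: "(\<Oplus>k\<in>{..m}. T (Suc k)) = \<zero>"
    using m by (intro add.finprod_one_eqI) auto
  have "(x \<oplus> y) [^] p = (\<Oplus>k\<in>{..p}. T k)"
    unfolding T_def by (rule binomial_cring[OF x y])
  also have "\<dots> = T p \<oplus> (\<Oplus>k\<in>{..Suc m}. T k)"
    unfolding m using car by (intro finsum_Suc) auto
  also have "(\<Oplus>k\<in>{..Suc m}. T k) = (\<Oplus>k\<in>{..m}. T (Suc k)) \<oplus> T 0"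
    using car by (intro finsum_Suc2) auto
  also have "\<dots> = T 0" unfolding mid using car by simp
  finally show ?thesis using x y by (simp add: T_def)
qed

end

text \<open>Coordinates with respect to a basis identify the span with lists of scalars.\<close>

lemma (in field) finite_span_card:
  assumes K: "subfield K R" "finite K" and Us: "independent K Us"
  shows "finite (Span K Us)" "card (Span K Us) = card K ^ length Us"
proof -
  have c: "set Us \<subseteq> carrier R" by (rule independent_in_carrier[OF Us])
  let ?L = "{Ks. set Ks \<subseteq> K \<and> length Ks = length Us}"
  have "bij_betw (\<lambda>Ks. combine Ks Us) ?L (Span K Us)"
    unfolding bij_betw_def
  proof
    show "(\<lambda>Ks. combine Ks Us) ` ?L = Span K Us"
      using Span_eq_combine_set_length_version[OF K(1) c] by auto
    show "inj_on (\<lambda>Ks. combine Ks Us) ?L"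
    proof (rule inj_onI)
      fix Ks Ks' assume a: "Ks \<in> ?L" "Ks' \<in> ?L" "combine Ks Us = combine Ks' Us"
      then have "combine Ks Us \<in> Span K Us"
        using Span_eq_combine_set_length_version[OF K(1) c] by blast
      then have "\<exists>!Ks'. set Ks' \<subseteq> K \<and> length Ks' = length Us \<and> combine Ks Us = combine Ks' Us"
        by (rule unique_decomposition[OF K(1) Us])
      then show "Ks = Ks'" using a by auto
    qed
  qed
  moreover have "finite ?L" "card ?L = card K ^ length Us"
    using finite_lists_length_eq[OF K(2)] card_lists_length_eq[OF K(2)] by auto
  ultimately show "finite (Span K Us)" "card (Span K Us) = card K ^ length Us"
    using bij_betw_finite[of _ ?L "Span K Us"] bij_betw_same_card[of _ ?L "Span K Us"] by auto
qed

lemma (in field) finite_dimension_finite: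
  assumes "subfield K R" "finite K" "finite_dimension K V"
  shows "finite V"
proof -
  obtain n where "dimension n K V" using assms(3) unfolding finite_dimension_def by blast
  then obtain Us where "independent K Us" "Span K Us = V" using exists_base[OF assms(1)] by blast
  then show ?thesis using finite_span_card(1)[OF assms(1,2)] by blast
qed

text \<open>With \<open>K\<close> the prime field this shows that finite fields have prime power order; with \<open>K\<close> a larger
  finite field it gives the divisibility of degrees.\<close>

lemma (in field) card_subfield_power:
  assumes K: "subfield K R" and F: "subring F R" "finite F" and KF: "K \<subseteq> F"
  shows "\<exists>d. card F = card K ^ d"
proof -
  obtain Us where Us: "set Us = F" using finite_list[OF F(2)] by blast
  have c: "set Us \<subseteq> carrier R" using Us subringE(1)[OF F(1)] by simp
  have "Span K Us = F"
  proof
    show "F \<subseteq> Span K Us" using Span_base_incl[OF K c] Us by simp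
    show "Span K Us \<subseteq> F"
    proof (rule Span_min[OF K c])
      show "subgroup F (add_monoid R)" by (rule subring.axioms(1)[OF F(1)])
      show "K <#> set Us \<subseteq> F"
        using Us KF subringE(6)[OF F(1)] unfolding set_mult_def by auto
    qed
  qed
  then obtain Vs where Vs: "independent K Vs" "Span K Vs = F"
    using filter_base[OF K c] by metis
  show ?thesis
    using finite_span_card(2)[OF K finite_subset[OF KF F(2)] Vs(1)] Vs(2) by blast
qed

lemma (in field) finite_subfield_roots:
  assumes C: "subfield C R" "finite C"
  shows "C = {x \<in> carrier R. x [^] card C = x}"
proof -
  have z: "\<zero> \<in> C" "\<one> \<in> C" using subringE(2,3)[OF subfieldE(1)[OF C(1)]] by auto
  then have "card C \<noteq> 0" using C(2) by auto
  then obtain k where k: "card C = Suc k" using not0_implies_Suc by blast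
  have n0: "C - {\<zero>} = {x \<in> carrier R. x [^] k = \<one>}"
    using finite_subfield_minus_zero[OF C] k by simp
  have iff: "x [^] k = \<one> \<longleftrightarrow> x [^] Suc k = x" if x: "x \<in> carrier R" "x \<noteq> \<zero>" for x
  proof
    assume "x [^] Suc k = x"
    then have "x [^] k \<otimes> x = \<one> \<otimes> x" using x by simp
    then show "x [^] k = \<one>" using x m_rcancel[of x "x [^] k" \<one>] by simp
  qed (use x in simp)
  show ?thesis
  proof (intro Set.set_eqI iffI)
    fix x assume x: "x \<in> C"
    then have xc: "x \<in> carrier R" using subfieldE(3)[OF C(1)] by blast
    show "x \<in> {x \<in> carrier R. x [^] card C = x}"
    proof (cases "x = \<zero>")
      case True
      then show ?thesis using k by simp
    next
      case False
      then have "x [^] k = \<one>" using x n0 by blast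
      then show ?thesis using iff[OF xc False] xc k by simp
    qed
  next
    fix x assume x: "x \<in> {x \<in> carrier R. x [^] card C = x}"
    show "x \<in> C"
    proof (cases "x = \<zero>")
      case True
      then show ?thesis using z by simp
    next
      case False
      then have "x [^] k = \<one>" using iff[of x] x k by simp
      then show ?thesis using n0 x by blast
    qed
  qed
qed

section \<open>Finite subfields of an absolutely algebraic field\<close>

locale prime_char_field = field R for R (structure) +
  fixes p :: nat
  assumes prime_p: "Factorial_Ring.prime p"
    and char_p: "[(int p)] \<cdot> \<one> = \<zero>"
begin

lemma p_gt_1: "1 < p"
  using prime_p by (rule prime_gt_1_nat)

lemma int_one_eq_zero_iff: "[(k::int)] \<cdot> \<one> = \<zero> \<longleftrightarrow> int p dvd k"
proof
  assume k: "[k] \<cdot> \<one> = \<zero>"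
  show "int p dvd k"
  proof (rule ccontr)
    assume "\<not> int p dvd k"
    then have "coprime (int p) k" using prime_elem_imp_coprime[of "int p" k] prime_p by simp
    moreover obtain a b where "a * int p + b * k = gcd (int p) k" using bezout_int by blast
    ultimately have "a * int p + b * k = 1" by simp
    then have "[(a * int p + b * k)] \<cdot> \<one> = \<one>" using int_one_one by simp
    then show False using k char_p by (simp add: int_one_add int_one_mult)
  qed
next
  assume "int p dvd k"
  then show "[k] \<cdot> \<one> = \<zero>" using char_p by (auto elim!: dvdE simp: int_one_mult)
qed

lemma prime_subring_eq: "prime_subring = (\<lambda>i. [(int i)] \<cdot> \<one>) ` {..<p}"
proof
  show "prime_subring \<subseteq> (\<lambda>i. [(int i)] \<cdot> \<one>) ` {..<p}"
  proof
    fix x assume "x \<in> prime_subring"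
    then obtain k :: int where k: "x = [k] \<cdot> \<one>" unfolding prime_subring_def by blast
    have "[k] \<cdot> \<one> = [(int p * (k div int p) + k mod int p)] \<cdot> \<one>" by simp
    also have "\<dots> = [(k mod int p)] \<cdot> \<one>"
      unfolding int_one_add int_one_mult char_p by simp
    finally have "x = [(int (nat (k mod int p)))] \<cdot> \<one>" using k p_gt_1 by simp
    moreover have "nat (k mod int p) < p" using p_gt_1 by (simp add: nat_less_iff)
    ultimately show "x \<in> (\<lambda>i. [(int i)] \<cdot> \<one>) ` {..<p}" by blast
  qed
qed (auto simp: prime_subring_def)

lemma finite_prime_subring: "finite prime_subring"
  unfolding prime_subring_eq by simp

lemma card_prime_subring: "card prime_subring = p"
proof -
  have "inj_on (\<lambda>i. [(int i)] \<cdot> \<one>) {..<p}"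
  proof (rule inj_onI)
    fix i j assume ij: "i \<in> {..<p}" "j \<in> {..<p}" "[(int i)] \<cdot> \<one> = [(int j)] \<cdot> \<one>"
    have "[(int i + - int j)] \<cdot> \<one> = \<zero>"
      unfolding int_one_add int_one_neg ij(3) by (simp add: r_neg)
    then have "int p dvd int i - int j" using int_one_eq_zero_iff by simp
    then have "int i mod int p = int j mod int p" by (simp add: mod_eq_dvd_iff)
    then show "i = j" using ij by (simp flip: of_nat_mod)
  qed
  then show ?thesis unfolding prime_subring_eq by (simp add: card_image)
qed

lemma prime_subfield: "subfield prime_subring R"
proof (rule subfieldI'[OF prime_subring_is_subring])
  fix x assume x: "x \<in> prime_subring - {\<zero>}"
  then obtain k :: int where k: "x = [k] \<cdot> \<one>" unfolding prime_subring_def by blast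
  then have "\<not> int p dvd k" using x int_one_eq_zero_iff by blast
  then have "coprime (int p) k" using prime_elem_imp_coprime[of "int p" k] prime_p by simp
  moreover obtain a b where "a * int p + b * k = gcd (int p) k" using bezout_int by blast
  ultimately have "a * int p + b * k = 1" by simp
  then have "[(a * int p + k * b)] \<cdot> \<one> = \<one>" using int_one_one by (simp add: mult.commute)
  then have "[k] \<cdot> \<one> \<otimes> [b] \<cdot> \<one> = \<one>" using char_p by (simp add: int_one_add int_one_mult)
  then have "inv x = [b] \<cdot> \<one>" unfolding k by (intro inv_unique_field) auto
  then show "inv x \<in> prime_subring" unfolding prime_subring_def by blast
qed

lemma frobenius_pow_add:
  "x \<in> carrier R \<Longrightarrow> y \<in> carrier R \<Longrightarrow> (x \<oplus> y) [^] (p ^ n) = x [^] (p ^ n) \<oplus> y [^] (p ^ n)"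
proof (induction n)
  case (Suc n)
  have "(x \<oplus> y) [^] (p ^ Suc n) = ((x \<oplus> y) [^] (p ^ n)) [^] p"
    using Suc.prems by (simp add: nat_pow_pow mult.commute)
  also have "\<dots> = (x [^] (p ^ n)) [^] p \<oplus> (y [^] (p ^ n)) [^] p"
    using Suc by (simp add: frobenius_add[OF prime_p char_p])
  finally show ?case using Suc.prems by (simp add: nat_pow_pow mult.commute)
qed simp

text \<open>The fixed points of the \<open>n\<close>-th power of Frobenius form the candidate for the subfield with
  \<open>p\<^sup>n\<close> elements; whether they are that many depends on \<open>R\<close>.\<close>

definition fixed_field :: "nat \<Rightarrow> 'a set" where
  "fixed_field n = {x \<in> carrier R. x [^] (p ^ n) = x}"

definition degrees :: "nat set" where
  "degrees = {n. 0 < n \<and> card (fixed_field n) = p ^ n}"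

lemma fixed_field_carrier: "fixed_field n \<subseteq> carrier R"
  unfolding fixed_field_def by blast

lemma fixed_field_subfield: "subfield (fixed_field n) R"
proof (rule subfieldI'[OF subringI])
  have pn: "0 < p ^ n" using p_gt_1 by simp
  then have z: "\<zero> [^] (p ^ n) = \<zero>" by (simp add: nat_pow_zero)
  show "fixed_field n \<subseteq> carrier R" by (rule fixed_field_carrier)
  show "\<one> \<in> fixed_field n" unfolding fixed_field_def by simp
  show "\<ominus> h \<in> fixed_field n" if "h \<in> fixed_field n" for h
  proof -
    have h: "h \<in> carrier R" "h [^] (p ^ n) = h" using that unfolding fixed_field_def by auto
    have "(\<ominus> h \<oplus> h) [^] (p ^ n) = (\<ominus> h) [^] (p ^ n) \<oplus> h"
      using frobenius_pow_add[of "\<ominus> h" h n] h by simp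
    then have "(\<ominus> h) [^] (p ^ n) \<oplus> h = \<zero>" using h z by (simp add: l_neg)
    then have "(\<ominus> h) [^] (p ^ n) = \<ominus> h" using h minus_equality[of "(\<ominus> h) [^] (p ^ n)" h] by simp
    then show ?thesis unfolding fixed_field_def using h by simp
  qed
  show "h1 \<otimes> h2 \<in> fixed_field n" if "h1 \<in> fixed_field n" "h2 \<in> fixed_field n" for h1 h2
    using that unfolding fixed_field_def by (auto simp: nat_pow_distrib)
  show "h1 \<oplus> h2 \<in> fixed_field n" if "h1 \<in> fixed_field n" "h2 \<in> fixed_field n" for h1 h2
    using that unfolding fixed_field_def by (auto simp: frobenius_pow_add)
  show "inv h \<in> fixed_field n" if "h \<in> fixed_field n - {\<zero>}" for h
  proof -
    have h: "h \<in> carrier R" "h [^] (p ^ n) = h" "h \<noteq> \<zero>" using that unfolding fixed_field_def by auto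
    have i: "inv h \<in> carrier R" using inv_carrier h by blast
    have "h [^] (p ^ n) \<otimes> inv h [^] (p ^ n) = (h \<otimes> inv h) [^] (p ^ n)"
      using h i by (simp add: nat_pow_distrib)
    also have "\<dots> = \<one>" using r_inv_nonzero[OF h(1,3)] by simp
    finally have "h \<otimes> inv h [^] (p ^ n) = \<one>" using h(2) by simp
    then have "inv h = inv h [^] (p ^ n)" using h i by (intro inv_unique_field) auto
    then show ?thesis unfolding fixed_field_def using i by simp
  qed
qed

lemma finite_fixed_field: "0 < n \<Longrightarrow> finite (fixed_field n)"
  and card_fixed_field_le: "0 < n \<Longrightarrow> card (fixed_field n) \<le> p ^ n"
proof -
  assume n: "0 < n"
  define k where "k = p ^ n - 1"
  have "1 < p ^ n" by (rule one_less_power[OF p_gt_1 n])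
  then have k: "p ^ n = Suc k" "0 < k" unfolding k_def by auto
  have sub: "fixed_field n \<subseteq> insert \<zero> {x \<in> carrier R. x [^] k = \<one>}"
  proof
    fix x assume "x \<in> fixed_field n"
    then have x: "x \<in> carrier R" "x [^] k \<otimes> x = \<one> \<otimes> x" unfolding fixed_field_def k by auto
    then show "x \<in> insert \<zero> {x \<in> carrier R. x [^] k = \<one>}"
      using m_rcancel[of x "x [^] k" \<one>] by auto
  qed
  note fin = card_roots_of_unity_le[OF k(2)]
  show "finite (fixed_field n)" using finite_subset[OF sub] fin(1) by simp
  have "card (fixed_field n) \<le> card (insert \<zero> {x \<in> carrier R. x [^] k = \<one>})"
    using fin(1) by (intro card_mono[OF _ sub]) simp
  also have "\<dots> \<le> Suc (card {x \<in> carrier R. x [^] k = \<one>})" by (rule card_insert_le_m1) simp_all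
  also have "\<dots> \<le> p ^ n" using fin(2) k(1) by simp
  finally show "card (fixed_field n) \<le> p ^ n" .
qed

lemma finite_subfield_eq_fixed_field:
  assumes "subfield C R" "finite C" "card C = p ^ n"
  shows "C = fixed_field n"
  using finite_subfield_roots[OF assms(1,2)] unfolding assms(3) fixed_field_def .

lemma finite_subfield_degree:
  assumes C: "subfield C R" "finite C"
  obtains n where "n \<in> degrees" "C = fixed_field n"
proof -
  obtain n where n: "card C = p ^ n"
    using card_subfield_power[OF prime_subfield subfieldE(1)[OF C(1)] C(2)
        prime_subring_subset[OF subfieldE(1)[OF C(1)]]] card_prime_subring by auto
  have "{\<zero>, \<one>} \<subseteq> C" using subringE(2,3)[OF subfieldE(1)[OF C(1)]] by simp
  then have "card {\<zero>, \<one>} \<le> card C" by (rule card_mono[OF C(2)])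
  then have "0 < n" using n by (cases n) auto
  then show thesis using that n finite_subfield_eq_fixed_field[OF C n] unfolding degrees_def by auto
qed

lemma GF_sub_iff: "0 < n \<Longrightarrow> GF_sub R p n K \<longleftrightarrow> n \<in> degrees \<and> K = fixed_field n"
  using finite_subfield_eq_fixed_field[of K n] fixed_field_subfield finite_fixed_field[of n]
  unfolding GF_sub_def degrees_def by blast

lemma card_p_subfield_eq:
  assumes "subfield K R" "finite K" "card K = p"
  shows "K = prime_subring"
  using card_seteq[OF assms(2) prime_subring_subset[OF subfieldE(1)[OF assms(1)]]]
    assms(3) card_prime_subring by simp

end

locale absolutely_algebraic_field = prime_char_field +
  assumes algebraic: "\<And>x. x \<in> carrier R \<Longrightarrow> (algebraic over prime_subring) x"
begin

text \<open>The subfield generated by \<open>x\<close> is a finite extension of the prime field, hence finite, and every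
  subring containing \<open>x\<close> contains it.\<close>

lemma element_degree:
  assumes x: "x \<in> carrier R"
  obtains n where "n \<in> degrees" "x \<in> fixed_field n"
    "\<And>S. subring S R \<Longrightarrow> x \<in> S \<Longrightarrow> fixed_field n \<subseteq> S"
proof -
  let ?C = "simple_extension prime_subring x"
  note P = prime_subring_is_subring
  have C: "subfield ?C R"
    using simple_extension_is_subfield[OF prime_subfield x] algebraic[OF x] by blast
  have "finite ?C"
    using finite_dimension_finite[OF prime_subfield finite_prime_subring]
      finite_dimension_simple_extension[OF prime_subfield x] algebraic[OF x] by blast
  then obtain n where n: "n \<in> degrees" "?C = fixed_field n" using finite_subfield_degree[OF C] by blast
  have "x \<in> fixed_field n" using simple_extension_mem[OF P x] n by simp
  moreover have "fixed_field n \<subseteq> S" if "subring S R" "x \<in> S" for S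
    using simple_extension_subring_incl[OF that(1) prime_subring_subset[OF that(1)] that(2)] n by simp
  ultimately show thesis using that n by blast
qed

lemma fixed_field_mono: "m dvd n \<Longrightarrow> fixed_field m \<subseteq> fixed_field n"
proof
  fix x assume "m dvd n" "x \<in> fixed_field m"
  then obtain c where x: "n = m * c" "x \<in> carrier R" "x [^] (p ^ m) = x"
    unfolding fixed_field_def by auto
  have "x [^] (p ^ (m * c)) = x"
  proof (induction c)
    case (Suc c)
    have "x [^] (p ^ (m * Suc c)) = (x [^] (p ^ (m * c))) [^] (p ^ m)"
      using x(2) by (simp add: nat_pow_pow power_add mult.commute)
    then show ?case using Suc x(3) by simp
  qed (use x in simp)
  then show "x \<in> fixed_field n" unfolding fixed_field_def using x by simp
qed

lemma fixed_field_subset_imp_dvd: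
  assumes "m \<in> degrees" "n \<in> degrees" "fixed_field m \<subseteq> fixed_field n"
  shows "m dvd n"
proof -
  have "0 < n" "card (fixed_field n) = p ^ n" "card (fixed_field m) = p ^ m"
    using assms unfolding degrees_def by auto
  then obtain d where "p ^ n = (p ^ m) ^ d"
    using card_subfield_power[OF fixed_field_subfield subfieldE(1)[OF fixed_field_subfield]
        finite_fixed_field assms(3)] by auto
  then have "n = m * d" using p_gt_1 by (simp add: power_mult[symmetric])
  then show ?thesis by simp
qed

text \<open>The multiplicative group of a finite field is cyclic of order \<open>p\<^sup>n - 1\<close>. If \<open>m\<close> divides \<open>n\<close>, a
  suitable power of a generator has \<open>p\<^sup>m - 1\<close> distinct powers, all of them fixed by the \<open>m\<close>-th
  power of Frobenius.\<close>

lemma degrees_dvd_closed: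
  assumes n: "n \<in> degrees" and m: "m dvd n" "0 < m"
  shows "m \<in> degrees"
proof -
  define N where "N = p ^ n - 1"
  define M where "M = p ^ m - 1"
  have n0: "0 < n" "card (fixed_field n) = p ^ n" using n unfolding degrees_def by auto
  have fin: "finite (fixed_field n)" "finite (fixed_field m)" using finite_fixed_field n0 m by auto
  interpret F: field "R\<lparr>carrier := fixed_field n\<rparr>"
    by (rule subfield_iff(2)[OF fixed_field_subfield])
  obtain a where a: "a \<in> fixed_field n - {\<zero>}"
    "fixed_field n - {\<zero>} = {a [^]\<^bsub>R\<lparr>carrier := fixed_field n\<rparr>\<^esub> i | i::nat. True}"
    using F.finite_field_mult_group_has_gen fin by auto
  have "a [^]\<^bsub>R\<lparr>carrier := fixed_field n\<rparr>\<^esub> i = a [^] i" for i :: nat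
    by (simp add: nat_pow_def)
  then have gen: "fixed_field n - {\<zero>} = range (\<lambda>i::nat. a [^] i)" using a(2) by auto
  have ac: "a \<in> carrier R" "a \<noteq> \<zero>" using a(1) fixed_field_carrier by auto
  have z: "\<zero> \<in> fixed_field k" for k using subringE(2)[OF subfieldE(1)[OF fixed_field_subfield]] .
  have cN: "card (range (\<lambda>i::nat. a [^] i)) = N"
    unfolding gen[symmetric] N_def using n0 fin z by simp
  have small: "a [^] d \<noteq> \<one>" if d: "0 < d" "d < N" for d :: nat
  proof
    assume e: "a [^] d = \<one>"
    have "a [^] i = a [^] (i mod d)" for i :: nat
    proof -
      have "a [^] i = a [^] (d * (i div d) + i mod d)" by simp
      also have "\<dots> = (a [^] d) [^] (i div d) \<otimes> a [^] (i mod d)"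
        using ac by (simp only: nat_pow_mult nat_pow_pow)
      finally show ?thesis using e ac by simp
    qed
    then have "range (\<lambda>i::nat. a [^] i) \<subseteq> (\<lambda>i. a [^] i) ` {..<d}"
      using d(1) by (metis (no_types, lifting) image_eqI image_subsetI lessThan_iff mod_less_divisor)
    then have "N \<le> card ((\<lambda>i. a [^] i) ` {..<d})"
      unfolding cN[symmetric] by (intro card_mono) auto
    also have "\<dots> \<le> d" using card_image_le[of "{..<d}"] by simp
    finally show False using d(2) by simp
  qed
  have aN: "a [^] N = \<one>"
  proof -
    have "a [^] (p ^ n) = a" using a(1) unfolding fixed_field_def by simp
    moreover have "p ^ n = Suc N" unfolding N_def using p_gt_1 by simp
    ultimately have "a [^] N \<otimes> a = \<one> \<otimes> a" using ac by simp
    then show ?thesis using ac m_rcancel[of a "a [^] N" \<one>] by simp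
  qed
  have "M dvd N"
  proof -
    obtain c where "n = m * c" using m(1) by (rule dvdE)
    then have "p ^ n = (p ^ m) ^ c" by (simp add: power_mult)
    then have "int N = int (p ^ m) ^ c - 1" unfolding N_def using p_gt_1 by (simp add: of_nat_diff)
    moreover have "int M = int (p ^ m) - 1" unfolding M_def using p_gt_1 by (simp add: of_nat_diff)
    moreover have "int (p ^ m) - 1 dvd int (p ^ m) ^ c - 1"
      unfolding power_diff_1_eq by (rule dvd_triv_left)
    ultimately have "int M dvd int N" by simp
    then show ?thesis by simp
  qed
  then obtain c where c: "N = M * c" by (rule dvdE)
  have "1 < p ^ n" by (rule one_less_power[OF p_gt_1 n0(1)])
  then have N0: "0 < N" unfolding N_def by simp
  then have c0: "0 < c" using c by (cases c) auto
  let ?b = "a [^] c"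
  have bc: "?b \<in> carrier R" "?b \<noteq> \<zero>" using ac pow_nonzero by auto
  have distinct: "False" if ij: "i < j" "j < M" "?b [^] i = ?b [^] j" for i j :: nat
  proof -
    have "?b [^] (j - i) \<otimes> ?b [^] i = ?b [^] j"
      using ij(1) bc by (simp add: nat_pow_mult)
    also have "\<dots> = \<one> \<otimes> ?b [^] i" using ij(3) bc by simp
    finally have "?b [^] (j - i) \<otimes> ?b [^] i = \<one> \<otimes> ?b [^] i" .
    then have "?b [^] (j - i) = \<one>"
      using bc m_rcancel[of "?b [^] i" "?b [^] (j - i)" \<one>] pow_nonzero[OF bc] by simp
    then have "a [^] (c * (j - i)) = \<one>" using ac by (simp add: nat_pow_pow)
    moreover have "0 < c * (j - i)" using c0 ij by simp
    moreover have "c * (j - i) < N"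
      using c ij c0 by (simp add: mult.commute)
    ultimately show False using small by blast
  qed
  have "inj_on (\<lambda>i. ?b [^] i) {..<M}"
    by (rule linorder_inj_onI) (use distinct in auto)
  then have "card ((\<lambda>i. ?b [^] i) ` {..<M}) = M" by (simp add: card_image)
  moreover have "(\<lambda>i. ?b [^] i) ` {..<M} \<subseteq> fixed_field m - {\<zero>}"
  proof
    fix y assume "y \<in> (\<lambda>i. ?b [^] i) ` {..<M}"
    then obtain i where y: "y = ?b [^] (i::nat)" by blast
    have "?b [^] M = \<one>" using ac aN c by (simp add: nat_pow_pow mult.commute)
    then have "y [^] M = \<one>" unfolding y using bc by (metis mult.commute nat_pow_one nat_pow_pow)
    moreover have "p ^ m = Suc M" unfolding M_def using p_gt_1 by simp
    ultimately show "y \<in> fixed_field m - {\<zero>}"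
      unfolding fixed_field_def using y bc pow_nonzero by auto
  qed
  ultimately have "M \<le> card (fixed_field m - {\<zero>})" using fin by (metis card_mono finite_Diff)
  moreover have "card (fixed_field m) = Suc (card (fixed_field m - {\<zero>}))"
    using card.remove[OF fin(2) z] .
  ultimately have ge: "p ^ m \<le> card (fixed_field m)" unfolding M_def by simp
  then have "card (fixed_field m) = p ^ m" using card_fixed_field_le[OF m(2)] by simp
  then show ?thesis unfolding degrees_def using m(2) by simp
qed

text \<open>The compositum of two finite subfields is finite and its degree is a common multiple of theirs; by
  divisor closure the least common multiple also occurs, inside the compositum.\<close>

lemma degrees_join:
  assumes m: "m \<in> degrees" and n: "n \<in> degrees"
  shows "lcm m n \<in> degrees"
    and "\<And>S. subring S R \<Longrightarrow> fixed_field m \<subseteq> S \<Longrightarrow> fixed_field n \<subseteq> S \<Longrightarrow> fixed_field (lcm m n) \<subseteq> S"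
proof -
  have pos: "0 < m" "0 < n" using m n unfolding degrees_def by auto
  obtain xs where xs: "set xs = fixed_field n" using finite_list[OF finite_fixed_field[OF pos(2)]] by blast
  let ?C = "finite_extension (fixed_field m) xs"
  have xc: "set xs \<subseteq> carrier R" using xs fixed_field_carrier by simp
  have alg: "(algebraic over (fixed_field m)) x" if "x \<in> set xs" for x
    using that xc algebraic algebraic_mono prime_subring_subset[OF subfieldE(1)[OF fixed_field_subfield]]
    by blast
  have sC: "subfield ?C R" using finite_extension_is_subfield[OF fixed_field_subfield xc alg] .
  have "finite_dimension (fixed_field m) ?C"
    using finite_extension_finite_dimension(1)[OF fixed_field_subfield xc alg] .
  then have "finite ?C"
    using finite_dimension_finite[OF fixed_field_subfield finite_fixed_field[OF pos(1)]] by blast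
  then obtain k where k: "k \<in> degrees" "?C = fixed_field k"
    using finite_subfield_degree[OF sC] by blast
  have "fixed_field m \<subseteq> ?C" using finite_extension_incl[OF fixed_field_carrier xc] .
  then have "m dvd k" using fixed_field_subset_imp_dvd[OF m k(1)] k(2) by simp
  moreover have "fixed_field n \<subseteq> ?C"
    using finite_extension_mem[OF subfieldE(1)[OF fixed_field_subfield] xc] xs by simp
  then have "n dvd k" using fixed_field_subset_imp_dvd[OF n k(1)] k(2) by simp
  ultimately have l: "lcm m n dvd k" by simp
  then show "lcm m n \<in> degrees" using degrees_dvd_closed[OF k(1) l] pos by (simp add: lcm_pos_nat)
  fix S assume S: "subring S R" "fixed_field m \<subseteq> S" "fixed_field n \<subseteq> S"
  then have "?C \<subseteq> S" using finite_extension_subring_incl[OF S(1,2)] xs by simp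
  then show "fixed_field (lcm m n) \<subseteq> S" using fixed_field_mono[OF l] k(2) by simp
qed

end

section \<open>Largest subrings avoiding a given finite subfield\<close>

lemma prime_power_dvd_lcm:
  fixes q m n :: nat
  assumes q: "Factorial_Ring.prime q" and "0 < m" "0 < n" and d: "q ^ a dvd lcm m n"
  shows "q ^ a dvd m \<or> q ^ a dvd n"
proof -
  have "lcm m n \<noteq> 0" using assms by simp
  then have "a \<le> multiplicity q (lcm m n)"
    using d q power_dvd_iff_le_multiplicity[of "lcm m n" q a] prime_gt_1_nat[OF q] by simp
  also have "multiplicity q (lcm m n) = max (multiplicity q m) (multiplicity q n)"
    using assms by (simp add: multiplicity_lcm)
  finally have "a \<le> multiplicity q m \<or> a \<le> multiplicity q n" by linarith
  then show ?thesis by (meson multiplicity_dvd')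
qed

lemma (in field) subring_update_iff:
  assumes F: "subring F R"
  shows "subring S (R\<lparr>carrier := F\<rparr>) \<longleftrightarrow> subring S R \<and> S \<subseteq> F"
proof -
  interpret F: ring "R\<lparr>carrier := F\<rparr>" by (rule subring_is_ring[OF F])
  have "S \<subseteq> F" if "subring S (R\<lparr>carrier := F\<rparr>)" using subringE(1)[OF that] by simp
  moreover have "subring S (R\<lparr>carrier := F\<rparr>) \<longleftrightarrow> subring S R" if "S \<subseteq> F"
    using F.subring_iff[of S] subring_iff[of S] that subringE(1)[OF F] by auto
  ultimately show ?thesis by blast
qed

lemma (in field) maximal_subring_update_iff:
  assumes F: "subring F R"
  shows "maximal_subring S (R\<lparr>carrier := F\<rparr>) \<longleftrightarrow> subring S R \<and> S \<subset> F \<and>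
    (\<forall>T. subring T R \<longrightarrow> S \<subseteq> T \<longrightarrow> T \<subseteq> F \<longrightarrow> T = S \<or> T = F)"
  unfolding maximal_subring_def subring_update_iff[OF F] by auto

context absolutely_algebraic_field
begin

lemma degrees_pos: "n \<in> degrees \<Longrightarrow> 0 < n"
  unfolding degrees_def by simp

lemma one_degree: "1 \<in> degrees"
proof -
  obtain n where "n \<in> degrees" using element_degree[OF one_closed] by blast
  then show ?thesis using degrees_dvd_closed[of n 1] by simp
qed

lemma mem_subring_iff:
  assumes S: "subring S R"
  shows "x \<in> S \<longleftrightarrow> (\<exists>n\<in>degrees. x \<in> fixed_field n \<and> fixed_field n \<subseteq> S)"
  using element_degree[of x] S subringE(1)[OF S] by (metis subsetD)

lemma subring_is_subfield:
  assumes S: "subring S R"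
  shows "subfield S R"
proof (rule subfieldI'[OF S])
  fix x assume x: "x \<in> S - {\<zero>}"
  then obtain n where n: "x \<in> fixed_field n" "fixed_field n \<subseteq> S" using mem_subring_iff[OF S] by blast
  then show "inv x \<in> S" using subfield_m_inv(1)[OF fixed_field_subfield, of x n] x by blast
qed

text \<open>A finite field is generated by its subfields of prime power degree.\<close>

lemma fixed_field_subset_if_prime_powers:
  assumes S: "subring S R" and "n \<in> degrees"
    and "\<And>q a. Factorial_Ring.prime q \<Longrightarrow> q ^ a dvd n \<Longrightarrow> fixed_field (q ^ a) \<subseteq> S"
  shows "fixed_field n \<subseteq> S"
  using assms(2,3)
proof (induction n rule: less_induct)
  case (less n)
  show ?case
  proof (cases "n = 1")
    case True
    then show ?thesis using less.prems(2)[of 2 0] by simp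
  next
    case False
    obtain q where q: "Factorial_Ring.prime q" "q dvd n" using prime_factor_nat[OF False] by blast
    have n0: "n \<noteq> 0" using degrees_pos[OF less.prems(1)] by simp
    have u: "\<not> is_unit q" using q(1) not_prime_unit by blast
    define a where "a = multiplicity q n"
    obtain m where m: "n = q ^ a * m" "\<not> q dvd m"
      using multiplicity_decompose'[OF n0 u] unfolding a_def by blast
    have a0: "a \<noteq> 0" using m q(2) by (metis mult_1 power_0)
    then have "1 < q ^ a" using one_less_power[OF prime_gt_1_nat[OF q(1)]] by simp
    have m0: "0 < m" using m n0 by (cases m) auto
    have mn: "m < n" unfolding m(1) using \<open>1 < q ^ a\<close> m0 by simp
    have dm: "m \<in> degrees" using degrees_dvd_closed[OF less.prems(1) _ m0] m(1) by simp
    have dq: "q ^ a \<in> degrees"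
      using degrees_dvd_closed[OF less.prems(1), of "q ^ a"] m(1) prime_gt_0_nat[OF q(1)] by simp
    have "fixed_field m \<subseteq> S"
      using less.IH[OF mn dm] less.prems(2) m(1) by (metis dvd_mult)
    moreover have "fixed_field (q ^ a) \<subseteq> S" using less.prems(2)[OF q(1)] m(1) by simp
    moreover have "lcm (q ^ a) m = n"
    proof -
      have "coprime (q ^ a) m" using prime_imp_coprime[OF q(1) m(2)] by simp
      then show ?thesis using m(1) by (simp add: lcm_coprime)
    qed
    ultimately show ?thesis using degrees_join(2)[OF dq dm S] by simp
  qed
qed

text \<open>Subrings will be given by sets of degrees. Closure under least common multiples makes the
  corresponding union of finite subfields directed.\<close>

lemma directed_union_subring:
  assumes D: "D \<subseteq> degrees" "D \<noteq> {}" "\<And>m n. m \<in> D \<Longrightarrow> n \<in> D \<Longrightarrow> lcm m n \<in> D"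
  shows "subring (\<Union>(fixed_field ` D)) R"
proof (rule subringI)
  note F = subringE[OF subfieldE(1)[OF fixed_field_subfield]]
  show "\<Union>(fixed_field ` D) \<subseteq> carrier R" using fixed_field_carrier by blast
  obtain d where "d \<in> D" using D(2) by blast
  then show "\<one> \<in> \<Union>(fixed_field ` D)" using F(3)[of d] by blast
  show "\<ominus> h \<in> \<Union>(fixed_field ` D)" if h: "h \<in> \<Union>(fixed_field ` D)" for h
  proof -
    obtain n where "n \<in> D" "h \<in> fixed_field n" using h by blast
    then show ?thesis using F(5)[of h n] by blast
  qed
  fix h1 h2 assume "h1 \<in> \<Union>(fixed_field ` D)" "h2 \<in> \<Union>(fixed_field ` D)"
  then obtain m n where mn: "m \<in> D" "h1 \<in> fixed_field m" "n \<in> D" "h2 \<in> fixed_field n" by blast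
  have "h1 \<in> fixed_field (lcm m n)" "h2 \<in> fixed_field (lcm m n)"
    using mn fixed_field_mono[of m "lcm m n"] fixed_field_mono[of n "lcm m n"] by auto
  then show "h1 \<otimes> h2 \<in> \<Union>(fixed_field ` D)" "h1 \<oplus> h2 \<in> \<Union>(fixed_field ` D)"
    using F(6,7)[of h1 "lcm m n" h2] D(3)[OF mn(1,3)] by blast+
qed

lemma fixed_field_subset_directed_union:
  assumes D: "D \<subseteq> degrees" "D \<noteq> {}" "\<And>m n. m \<in> D \<Longrightarrow> n \<in> D \<Longrightarrow> lcm m n \<in> D"
    and n: "n \<in> degrees" "fixed_field n \<subseteq> \<Union>(fixed_field ` D)"
  shows "\<exists>d\<in>D. n dvd d"
proof -
  have "finite A \<Longrightarrow> A \<subseteq> \<Union>(fixed_field ` D) \<Longrightarrow> \<exists>d\<in>D. A \<subseteq> fixed_field d" for A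
  proof (induction A rule: finite_induct)
    case empty
    then show ?case using D(2) by blast
  next
    case (insert x A)
    then obtain d e where de: "d \<in> D" "A \<subseteq> fixed_field d" "e \<in> D" "x \<in> fixed_field e" by auto
    then have "insert x A \<subseteq> fixed_field (lcm d e)"
      using fixed_field_mono[of d "lcm d e"] fixed_field_mono[of e "lcm d e"] by auto
    then show ?case using D(3)[OF de(1,3)] by blast
  qed
  then obtain d where d: "d \<in> D" "fixed_field n \<subseteq> fixed_field d"
    using finite_fixed_field[OF degrees_pos[OF n(1)]] n(2) by blast
  then have "n dvd d" using fixed_field_subset_imp_dvd n(1) D(1) by blast
  then show ?thesis using d(1) by blast
qed

text \<open>For a prime power \<open>r > 1\<close> in \<open>degrees\<close> this is the largest subring that does not contain the subfield
  of degree \<open>r\<close>; \<open>r\<close> has to be a prime power for the index set to be closed under least common multiples.\<close>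

definition avoiding_subring :: "nat \<Rightarrow> 'a set" where
  "avoiding_subring r = \<Union>(fixed_field ` {n \<in> degrees. \<not> r dvd n})"

lemma avoiding_index_directed:
  assumes q: "Factorial_Ring.prime q" and a: "0 < a"
  defines "D \<equiv> {n \<in> degrees. \<not> q ^ a dvd n}"
  shows "D \<subseteq> degrees" "D \<noteq> {}" "\<And>m n. m \<in> D \<Longrightarrow> n \<in> D \<Longrightarrow> lcm m n \<in> D"
proof -
  show "D \<subseteq> degrees" unfolding D_def by blast
  have "1 < q ^ a" by (rule one_less_power[OF prime_gt_1_nat[OF q] a])
  then have "1 \<in> D" unfolding D_def using one_degree a by auto
  then show "D \<noteq> {}" by blast
  show "lcm m n \<in> D" if "m \<in> D" "n \<in> D" for m n
    using that degrees_join(1)[of m n] prime_power_dvd_lcm[OF q, of m n a] degrees_pos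
    unfolding D_def by auto
qed

lemma avoiding_subring_subring:
  assumes "Factorial_Ring.prime q" "0 < a"
  shows "subring (avoiding_subring (q ^ a)) R"
  unfolding avoiding_subring_def using directed_union_subring[OF avoiding_index_directed[OF assms]] .

lemma fixed_field_subset_avoiding:
  "n \<in> degrees \<Longrightarrow> \<not> r dvd n \<Longrightarrow> fixed_field n \<subseteq> avoiding_subring r"
  unfolding avoiding_subring_def by blast

lemma fixed_field_not_subset_avoiding:
  assumes "Factorial_Ring.prime q" "0 < a" "q ^ a \<in> degrees"
  shows "\<not> fixed_field (q ^ a) \<subseteq> avoiding_subring (q ^ a)"
  using fixed_field_subset_directed_union[OF avoiding_index_directed[OF assms(1,2)] assms(3)]
  unfolding avoiding_subring_def by blast

text \<open>An element of \<open>S\<close> whose degree were a multiple of \<open>r\<close> would drag the subfield of degree \<open>r\<close> into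
  \<open>S\<close>.\<close>

lemma subset_avoiding_subring:
  assumes S: "subring S R" and "\<not> fixed_field r \<subseteq> S"
  shows "S \<subseteq> avoiding_subring r"
proof
  fix x assume "x \<in> S"
  then obtain n where n: "n \<in> degrees" "x \<in> fixed_field n" "fixed_field n \<subseteq> S"
    using mem_subring_iff[OF S] by blast
  then have "\<not> r dvd n" using fixed_field_mono[of r n] assms(2) by blast
  then show "x \<in> avoiding_subring r" using fixed_field_subset_avoiding n by blast
qed

lemma prime_power_dvd_prime_power:
  fixes q s :: nat
  assumes "Factorial_Ring.prime q" "Factorial_Ring.prime s" "0 < e" "q ^ e dvd s ^ c"
  shows "s = q"
proof -
  have "q dvd s ^ c" using assms(3,4) dvd_power[of e q] dvd_trans by blast
  then show ?thesis using assms(1,2) prime_dvd_power primes_dvd_imp_eq by blast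
qed

text \<open>A subring of \<open>F\<close> strictly larger than the largest one that avoids degree \<open>q\<^sup>e\<close> contains the
  subfield of that degree. If \<open>q\<^sup>e\<close> is the largest power of \<open>q\<close> among the degrees occurring in \<open>F\<close>, it
  thus contains all subfields of \<open>F\<close> of prime power degree.\<close>

lemma maximal_subring_avoiding:
  assumes F: "subring F R" and q: "Factorial_Ring.prime q" "0 < e"
    and e: "q ^ e \<in> degrees" "fixed_field (q ^ e) \<subseteq> F"
    and top: "\<And>b. q ^ b \<in> degrees \<Longrightarrow> fixed_field (q ^ b) \<subseteq> F \<Longrightarrow> b \<le> e"
  shows "maximal_subring (F \<inter> avoiding_subring (q ^ e)) (R\<lparr>carrier := F\<rparr>)"
  unfolding maximal_subring_update_iff[OF F]
proof (intro conjI allI impI)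
  let ?W = "avoiding_subring (q ^ e)"
  have W: "subring ?W R" by (rule avoiding_subring_subring[OF q])
  show "subring (F \<inter> ?W) R" by (rule subring_inter[OF F W])
  show "F \<inter> ?W \<subset> F" using fixed_field_not_subset_avoiding[OF q e(1)] e(2) by blast
  fix S assume S: "subring S R" "F \<inter> ?W \<subseteq> S" "S \<subseteq> F"
  show "S = F \<inter> ?W \<or> S = F"
  proof (cases "fixed_field (q ^ e) \<subseteq> S")
    case False
    then show ?thesis using subset_avoiding_subring[OF S(1)] S by blast
  next
    case True
    have "F \<subseteq> S"
    proof
      fix x assume "x \<in> F"
      then obtain n where n: "n \<in> degrees" "x \<in> fixed_field n" "fixed_field n \<subseteq> F"
        using mem_subring_iff[OF F] by blast
      have "fixed_field n \<subseteq> S"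
      proof (rule fixed_field_subset_if_prime_powers[OF S(1) n(1)])
        fix s c assume s: "Factorial_Ring.prime s" "s ^ c dvd n"
        have d: "s ^ c \<in> degrees"
          using degrees_dvd_closed[OF n(1) s(2)] prime_gt_0_nat[OF s(1)] by simp
        have f: "fixed_field (s ^ c) \<subseteq> F" using fixed_field_mono[OF s(2)] n(3) by blast
        show "fixed_field (s ^ c) \<subseteq> S"
        proof (cases "q ^ e dvd s ^ c")
          case True
          then have "s = q" using prime_power_dvd_prime_power[OF q(1) s(1) q(2)] by blast
          then have "c \<le> e" using top d f by blast
          then show ?thesis
            using fixed_field_mono[OF le_imp_power_dvd, of c e q] \<open>fixed_field (q ^ e) \<subseteq> S\<close> \<open>s = q\<close>
            by blast
        next
          case False
          then show ?thesis using fixed_field_subset_avoiding[OF d] f S(2) by blast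
        qed
      qed
      then show "x \<in> S" using n(2) by blast
    qed
    then show ?thesis using S(3) by blast
  qed
qed

text \<open>Conversely a maximal subring misses some finite subfield, hence one of prime power degree \<open>q\<^sup>a\<close>,
  and so is the largest subring avoiding it. Avoiding degree \<open>q\<^sup>a\<^sup>+\<^sup>1\<close> instead would give a larger
  proper subring if that degree occurred.\<close>

lemma maximal_subring_is_avoiding:
  assumes M: "maximal_subring M R"
  obtains q a where "Factorial_Ring.prime q" "0 < a" "q ^ a \<in> degrees" "q ^ Suc a \<notin> degrees"
    "M = avoiding_subring (q ^ a)"
proof -
  have sM: "subring M R" "M \<noteq> carrier R"
    and mx: "\<And>T. subring T R \<Longrightarrow> M \<subseteq> T \<Longrightarrow> T = M \<or> T = carrier R"
    using M unfolding maximal_subring_def by blast+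
  obtain x where x: "x \<in> carrier R" "x \<notin> M" using sM subringE(1)[OF sM(1)] by blast
  obtain n where n: "n \<in> degrees" "x \<in> fixed_field n" using element_degree[OF x(1)] by blast
  then have "\<not> fixed_field n \<subseteq> M" using x by blast
  then obtain q a where q: "Factorial_Ring.prime q" "q ^ a dvd n" "\<not> fixed_field (q ^ a) \<subseteq> M"
    using fixed_field_subset_if_prime_powers[OF sM(1) n(1)] by blast
  have d: "q ^ a \<in> degrees" using degrees_dvd_closed[OF n(1) q(2)] prime_gt_0_nat[OF q(1)] by simp
  have a: "0 < a"
  proof (rule ccontr)
    assume "\<not> 0 < a"
    then have "q ^ a = 1" by simp
    moreover obtain m where m: "m \<in> degrees" "fixed_field m \<subseteq> M"
      using mem_subring_iff[OF sM(1), of \<one>] subringE(3)[OF sM(1)] by blast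
    ultimately show False using q(3) fixed_field_mono[of 1 m] by auto
  qed
  have eq: "M = avoiding_subring (q ^ b)" if b: "0 < b" "q ^ b \<in> degrees" "\<not> fixed_field (q ^ b) \<subseteq> M" for b
  proof -
    have "avoiding_subring (q ^ b) \<noteq> carrier R"
      using fixed_field_not_subset_avoiding[OF q(1) b(1,2)] fixed_field_carrier by blast
    then show ?thesis
      using mx[OF avoiding_subring_subring[OF q(1) b(1)] subset_avoiding_subring[OF sM(1) b(3)]] by simp
  qed
  have Ma: "M = avoiding_subring (q ^ a)" by (rule eq[OF a d q(3)])
  have "q ^ Suc a \<notin> degrees"
  proof
    assume s: "q ^ Suc a \<in> degrees"
    have "\<not> fixed_field (q ^ Suc a) \<subseteq> M"
      using fixed_field_mono[OF le_imp_power_dvd, of a "Suc a" q] q(3) by auto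
    then have "M = avoiding_subring (q ^ Suc a)" using eq[of "Suc a"] s by simp
    moreover have "\<not> q ^ Suc a dvd q ^ a"
      using power_dvd_imp_le[of q "Suc a" a] prime_gt_1_nat[OF q(1)] by auto
    ultimately have "fixed_field (q ^ a) \<subseteq> M" using fixed_field_subset_avoiding[OF d] by simp
    then show False using q(3) by blast
  qed
  then show thesis using that q(1) a d Ma by blast
qed

text \<open>These are the primes whose exponent in the supernatural number attached to \<open>R\<close> is positive and
  finite.\<close>

definition bounded_primes :: "nat set" where
  "bounded_primes = {q. Factorial_Ring.prime q \<and> q \<in> degrees \<and> (\<exists>a. q ^ a \<notin> degrees)}"

lemma bounded_primes_exponent:
  assumes "q \<in> bounded_primes"
  obtains e where "0 < e" "\<And>b. q ^ b \<in> degrees \<longleftrightarrow> b \<le> e"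
proof -
  have q: "Factorial_Ring.prime q" "q \<in> degrees" and ex: "\<exists>a. q ^ a \<notin> degrees"
    using assms unfolding bounded_primes_def by auto
  define m where "m = (LEAST a. q ^ a \<notin> degrees)"
  have m: "q ^ m \<notin> degrees" unfolding m_def by (rule LeastI_ex[OF ex])
  have below: "q ^ b \<in> degrees" if "b < m" for b using not_less_Least that unfolding m_def by blast
  have above: "q ^ b \<notin> degrees" if "m \<le> b" for b
    using degrees_dvd_closed[of "q ^ b" "q ^ m"] m le_imp_power_dvd[OF that] prime_gt_0_nat[OF q(1)] by auto
  have "m \<noteq> 0" using m one_degree by (metis power_0)
  moreover have "m \<noteq> 1" using m q(2) by (metis power_one_right)
  ultimately have "0 < m - 1" by simp
  moreover have "q ^ b \<in> degrees \<longleftrightarrow> b \<le> m - 1" for b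
  proof (cases "b < m")
    case True
    then show ?thesis using below[of b] by simp
  next
    case False
    then show ?thesis using above[of b] \<open>0 < m - 1\<close> by simp
  qed
  ultimately show thesis by (rule that)
qed

text \<open>Sending a bounded prime \<open>q\<close> to the largest subring avoiding its top power is a bijection onto the
  maximal subrings.\<close>

lemma finite_maximal_subrings_iff:
  "finite {S. maximal_subring S R} \<longleftrightarrow> finite bounded_primes"
proof -
  have "\<exists>e. 0 < e \<and> (\<forall>b. q ^ b \<in> degrees \<longleftrightarrow> b \<le> e)" if q: "q \<in> bounded_primes" for q
    by (rule bounded_primes_exponent[OF q]) blast
  then obtain e where e: "\<And>q. q \<in> bounded_primes \<Longrightarrow> 0 < e q \<and> (\<forall>b. q ^ b \<in> degrees \<longleftrightarrow> b \<le> e q)"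
    by metis
  then have e: "0 < e q" "q ^ b \<in> degrees \<longleftrightarrow> b \<le> e q" if "q \<in> bounded_primes" for q b
    using that by blast+
  let ?M = "\<lambda>q. avoiding_subring (q ^ e q)"
  have pr: "Factorial_Ring.prime q" if "q \<in> bounded_primes" for q
    using that unfolding bounded_primes_def by blast
  have sub: "{S. maximal_subring S R} \<subseteq> ?M ` bounded_primes"
  proof
    fix S assume "S \<in> {S. maximal_subring S R}"
    then obtain q a where q: "Factorial_Ring.prime q" "0 < a" "q ^ a \<in> degrees" "q ^ Suc a \<notin> degrees"
      "S = avoiding_subring (q ^ a)" using maximal_subring_is_avoiding by blast
    have "q \<in> degrees"
      using degrees_dvd_closed[OF q(3), of q] q(2) prime_gt_0_nat[OF q(1)] by (simp add: dvd_power)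
    then have b: "q \<in> bounded_primes" unfolding bounded_primes_def using q by blast
    then have "a = e q" using e(2)[OF b, of a] e(2)[OF b, of "Suc a"] q by simp
    then show "S \<in> ?M ` bounded_primes" using q(5) b by blast
  qed
  have mem: "?M q \<in> {S. maximal_subring S R}" if q: "q \<in> bounded_primes" for q
  proof -
    have "maximal_subring (carrier R \<inter> ?M q) (R\<lparr>carrier := carrier R\<rparr>)"
      using e[OF q] fixed_field_carrier
      by (intro maximal_subring_avoiding[OF carrier_is_subring pr[OF q]]) auto
    moreover have "carrier R \<inter> ?M q = ?M q"
      using subringE(1)[OF avoiding_subring_subring[OF pr[OF q] e(1)[OF q]]] by blast
    ultimately show ?thesis by simp
  qed
  have "inj_on ?M bounded_primes"
  proof (rule inj_onI, rule ccontr)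
    fix q s assume qs: "q \<in> bounded_primes" "s \<in> bounded_primes" "?M q = ?M s" "q \<noteq> s"
    have d: "s ^ e s \<in> degrees" using e(2)[OF qs(2)] by simp
    have "\<not> q ^ e q dvd s ^ e s"
      using prime_power_dvd_prime_power[OF pr[OF qs(1)] pr[OF qs(2)] e(1)[OF qs(1)]] qs(4) by blast
    then have "fixed_field (s ^ e s) \<subseteq> ?M q" using fixed_field_subset_avoiding[OF d] by blast
    then show False
      using fixed_field_not_subset_avoiding[OF pr[OF qs(2)] e(1)[OF qs(2)] d] qs(3) by simp
  qed
  then have "finite (?M ` bounded_primes) \<longleftrightarrow> finite bounded_primes" by (rule finite_image_iff)
  moreover have "?M ` bounded_primes = {S. maximal_subring S R}" using sub mem by blast
  ultimately show ?thesis by simp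
qed

text \<open>A finite basis of \<open>R\<close> over \<open>F\<close> lies in one finite subfield, of degree \<open>N\<close> say. If neither \<open>F\<close>
  nor this field contains the subfield of degree \<open>q\<^sup>a\<close>, then both are contained in the largest
  subring avoiding it, and so is all of \<open>R\<close>.\<close>

lemma finite_dimension_prime_powers:
  assumes F: "subfield F R" and fd: "finite_dimension F (carrier R)"
  shows "\<exists>N>0. \<forall>q a. Factorial_Ring.prime q \<longrightarrow> 0 < a \<longrightarrow> q ^ a \<in> degrees \<longrightarrow>
    fixed_field (q ^ a) \<subseteq> F \<or> q ^ a dvd N"
proof -
  obtain d where "dimension d F (carrier R)" using fd unfolding finite_dimension_def by blast
  then obtain Us where Us: "set Us \<subseteq> carrier R" "Span F Us = carrier R"
    using exists_base[OF F] by blast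
  have "\<exists>N\<in>degrees. set l \<subseteq> fixed_field N" if "set l \<subseteq> carrier R" for l
    using that
  proof (induction l)
    case Nil
    then show ?case using one_degree by auto
  next
    case (Cons x l)
    then obtain N where N: "N \<in> degrees" "set l \<subseteq> fixed_field N" by auto
    have "x \<in> carrier R" using Cons.prems by simp
    then obtain n where n: "n \<in> degrees" "x \<in> fixed_field n" using element_degree by blast
    have "set (x # l) \<subseteq> fixed_field (lcm n N)"
      using N n fixed_field_mono[of n "lcm n N"] fixed_field_mono[of N "lcm n N"] by auto
    then show ?case using degrees_join(1)[OF n(1) N(1)] by blast
  qed
  then obtain N where N: "N \<in> degrees" "set Us \<subseteq> fixed_field N" using Us(1) by blast
  have "fixed_field (q ^ a) \<subseteq> F \<or> q ^ a dvd N"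
    if q: "Factorial_Ring.prime q" "0 < a" "q ^ a \<in> degrees" for q a
  proof (rule ccontr)
    assume n: "\<not> ?thesis"
    let ?W = "avoiding_subring (q ^ a)"
    have W: "subring ?W R" by (rule avoiding_subring_subring[OF q(1,2)])
    have "F \<subseteq> ?W" using subset_avoiding_subring[OF subfieldE(1)[OF F]] n by blast
    moreover have "set Us \<subseteq> ?W" using fixed_field_subset_avoiding[OF N(1)] N(2) n by blast
    ultimately have "F <#> set Us \<subseteq> ?W" using subringE(6)[OF W] unfolding set_mult_def by blast
    then have "Span F Us \<subseteq> ?W" using Span_min[OF F Us(1) subring.axioms(1)[OF W]] by blast
    then show False using Us(2) fixed_field_not_subset_avoiding[OF q] fixed_field_carrier by blast
  qed
  then show ?thesis using degrees_pos[OF N(1)] by blast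
qed

end

section \<open>The subfield \<open>L(E)\<close>\<close>

context absolutely_algebraic_field
begin

lemma ring_char_eq: "ring_char R = p"
proof -
  have nat: "[n] \<cdot> \<one> = \<zero> \<longleftrightarrow> p dvd n" for n :: nat
    using int_one_eq_zero_iff[of "int n"] by (simp add: add_pow_int_ge)
  have eq: "add.ord \<one> dvd n \<longleftrightarrow> p dvd n" for n
    unfolding nat[of n, symmetric] by (rule add.pow_eq_id[OF one_closed, symmetric])
  have "add.ord \<one> dvd p" unfolding eq by simp
  moreover have "p dvd add.ord \<one>" unfolding eq[symmetric] by simp
  ultimately show ?thesis unfolding ring_char_def by (rule dvd_antisym)
qed

lemma FG_eq: "FG R = degrees"
  using degrees_pos by (auto simp: FG_def ring_char_eq GF_sub_iff)

text \<open>These are the members of \<open>T_prime (FG R)\<close> for which \<open>R\<close> has a subfield of that degree, which are the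
  ones that contribute to \<open>L(E)\<close>.\<close>

definition unbounded_degrees :: "nat set" where
  "unbounded_degrees = {n \<in> degrees. \<forall>q. Factorial_Ring.prime q \<longrightarrow> q dvd n \<longrightarrow> (\<forall>b. q ^ b \<in> degrees)}"

lemma L_sub_eq: "L_sub R = \<Union>(fixed_field ` unbounded_degrees)"
proof -
  have "q \<in> T_infty degrees \<longleftrightarrow> Factorial_Ring.prime q \<and> (\<forall>b. q ^ b \<in> degrees)" for q
  proof -
    have "q ^ b \<in> degrees" if "\<forall>n>0. q ^ n \<in> degrees" for b
      using that one_degree by (cases "b = 0") auto
    then show ?thesis unfolding T_infty_def by blast
  qed
  then have "T_prime degrees \<inter> degrees = unbounded_degrees"
    unfolding T_prime_def unbounded_degrees_def using degrees_pos by auto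
  moreover have "GF_sub R p n K \<longleftrightarrow> n \<in> degrees \<and> K = fixed_field n" if "n \<in> T_prime degrees" for n K
    using that by (intro GF_sub_iff) (simp add: T_prime_def)
  then have "{K. \<exists>n\<in>T_prime degrees. GF_sub R p n K} = fixed_field ` (T_prime degrees \<inter> degrees)"
    by auto
  ultimately show ?thesis unfolding L_sub_def FG_eq ring_char_eq by simp
qed

lemma one_unbounded: "1 \<in> unbounded_degrees"
  unfolding unbounded_degrees_def using one_degree by (auto simp: not_prime_unit)

lemma unbounded_degrees_directed:
  "unbounded_degrees \<subseteq> degrees" "unbounded_degrees \<noteq> {}"
  "m \<in> unbounded_degrees \<Longrightarrow> n \<in> unbounded_degrees \<Longrightarrow> lcm m n \<in> unbounded_degrees"
proof -
  show "unbounded_degrees \<subseteq> degrees" unfolding unbounded_degrees_def by blast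
  show "unbounded_degrees \<noteq> {}" using one_unbounded by blast
  assume mn: "m \<in> unbounded_degrees" "n \<in> unbounded_degrees"
  then have d: "m \<in> degrees" "n \<in> degrees" unfolding unbounded_degrees_def by auto
  have "q dvd m \<or> q dvd n" if "Factorial_Ring.prime q" "q dvd lcm m n" for q
    using prime_power_dvd_lcm[OF that(1) degrees_pos[OF d(1)] degrees_pos[OF d(2)], of 1] that(2) by simp
  then show "lcm m n \<in> unbounded_degrees"
    using mn degrees_join(1)[OF d] unfolding unbounded_degrees_def by blast
qed

lemma L_sub_subring: "subring (L_sub R) R"
  unfolding L_sub_eq by (rule directed_union_subring[OF unbounded_degrees_directed])

lemma L_sub_subfield: "subfield (L_sub R) R"
  by (rule subring_is_subfield[OF L_sub_subring])

lemma fixed_field_subset_L_sub_iff: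
  assumes n: "n \<in> degrees"
  shows "fixed_field n \<subseteq> L_sub R \<longleftrightarrow> n \<in> unbounded_degrees"
proof
  assume "fixed_field n \<subseteq> L_sub R"
  then obtain d where "d \<in> unbounded_degrees" "n dvd d"
    using fixed_field_subset_directed_union[OF unbounded_degrees_directed n] unfolding L_sub_eq by blast
  then show "n \<in> unbounded_degrees" using n dvd_trans unfolding unbounded_degrees_def by blast
next
  assume "n \<in> unbounded_degrees"
  then show "fixed_field n \<subseteq> L_sub R" unfolding L_sub_eq by blast
qed

lemma unbounded_prime_power_subset_L_sub:
  assumes "Factorial_Ring.prime q" "\<And>b. q ^ b \<in> degrees"
  shows "fixed_field (q ^ a) \<subseteq> L_sub R"
proof -
  have "s = q" if "Factorial_Ring.prime s" "s dvd q ^ a" for s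
    using that assms(1) prime_dvd_power primes_dvd_imp_eq by blast
  then have "q ^ a \<in> unbounded_degrees" unfolding unbounded_degrees_def using assms(2) by blast
  then show ?thesis unfolding L_sub_eq by blast
qed

text \<open>Only the boundedly occurring primes separate \<open>L(E)\<close> from \<open>E\<close>. When they are finitely many,
  adjoining the finitely many subfields of maximal \<open>q\<close>-power degree gives everything.\<close>

lemma finite_dimension_L_sub_iff:
  "finite_dimension (L_sub R) (carrier R) \<longleftrightarrow> finite bounded_primes"
proof
  assume fd: "finite_dimension (L_sub R) (carrier R)"
  obtain N where N: "0 < N" "\<forall>q a. Factorial_Ring.prime q \<longrightarrow> 0 < a \<longrightarrow> q ^ a \<in> degrees \<longrightarrow>
      fixed_field (q ^ a) \<subseteq> L_sub R \<or> q ^ a dvd N"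
    using finite_dimension_prime_powers[OF L_sub_subfield fd] by (elim exE conjE) (rule that)
  have "bounded_primes \<subseteq> {q. q dvd N}"
  proof
    fix q assume "q \<in> bounded_primes"
    then have q: "Factorial_Ring.prime q" "q \<in> degrees" "\<exists>a. q ^ a \<notin> degrees"
      unfolding bounded_primes_def by auto
    have "q \<notin> unbounded_degrees" using q(1,3) dvd_refl[of q] unfolding unbounded_degrees_def by auto
    then have "\<not> fixed_field q \<subseteq> L_sub R" using fixed_field_subset_L_sub_iff[OF q(2)] by blast
    then show "q \<in> {q. q dvd N}" using N(2)[rule_format, OF q(1), of 1] q(2) by simp
  qed
  then show "finite bounded_primes" by (rule finite_subset[OF _ finite_divisors_nat[OF N(1)]])
next
  assume fin: "finite bounded_primes"
  have "\<exists>e. 0 < e \<and> (\<forall>b. q ^ b \<in> degrees \<longleftrightarrow> b \<le> e)" if q: "q \<in> bounded_primes" for q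
    by (rule bounded_primes_exponent[OF q]) blast
  then obtain e where e: "\<And>q. q \<in> bounded_primes \<Longrightarrow> 0 < e q \<and> (\<forall>b. q ^ b \<in> degrees \<longleftrightarrow> b \<le> e q)"
    by metis
  define Y where "Y = (\<Union>q\<in>bounded_primes. fixed_field (q ^ e q))"
  have "finite (fixed_field (q ^ e q))" if "q \<in> bounded_primes" for q
  proof -
    have "q ^ e q \<in> degrees" using e[OF that] by simp
    then show ?thesis by (rule finite_fixed_field[OF degrees_pos])
  qed
  then have "finite Y" unfolding Y_def using fin by blast
  then obtain xs where xs: "set xs = Y" using finite_list by blast
  have xc: "set xs \<subseteq> carrier R" unfolding xs Y_def using fixed_field_carrier by blast
  have alg: "(algebraic over (L_sub R)) x" if "x \<in> set xs" for x
    using that xc by (intro algebraic_mono[OF prime_subring_subset[OF L_sub_subring] algebraic]) blast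
  let ?C = "finite_extension (L_sub R) xs"
  have fd: "finite_dimension (L_sub R) ?C"
    using finite_extension_finite_dimension(1)[OF L_sub_subfield xc alg] .
  have sC: "subring ?C R" by (rule finite_extension_is_subring[OF L_sub_subring xc])
  have LC: "L_sub R \<subseteq> ?C" by (rule finite_extension_incl[OF subringE(1)[OF L_sub_subring] xc])
  have YC: "Y \<subseteq> ?C" using finite_extension_mem[OF L_sub_subring xc] xs by simp
  have "carrier R \<subseteq> ?C"
  proof
    fix x assume x: "x \<in> carrier R"
    obtain n where n: "n \<in> degrees" "x \<in> fixed_field n" by (rule element_degree[OF x])
    have "fixed_field n \<subseteq> ?C"
    proof (rule fixed_field_subset_if_prime_powers[OF sC n(1)])
      fix q a assume q: "Factorial_Ring.prime q" "q ^ a dvd n"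
      have d: "q ^ a \<in> degrees" using degrees_dvd_closed[OF n(1) q(2)] prime_gt_0_nat[OF q(1)] by simp
      show "fixed_field (q ^ a) \<subseteq> ?C"
      proof (cases "\<forall>b. q ^ b \<in> degrees")
        case True
        then show ?thesis using unbounded_prime_power_subset_L_sub[OF q(1)] LC by blast
      next
        case False
        show ?thesis
        proof (cases "a = 0")
          case True
          then show ?thesis
            using fixed_field_subset_L_sub_iff[OF one_degree] LC one_unbounded by simp
        next
          case nz: False
          have "q \<in> degrees"
            using degrees_dvd_closed[OF d, of q] nz prime_gt_0_nat[OF q(1)] by (simp add: dvd_power)
          then have b: "q \<in> bounded_primes" unfolding bounded_primes_def using q(1) False by blast
          then have "a \<le> e q" using e[OF b] d by blast
          then have "fixed_field (q ^ a) \<subseteq> fixed_field (q ^ e q)"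
            by (intro fixed_field_mono le_imp_power_dvd)
          then show ?thesis using YC b unfolding Y_def by blast
        qed
      qed
    qed
    then show "x \<in> ?C" using n(2) by blast
  qed
  then have "?C = carrier R" using subringE(1)[OF sC] by blast
  then show "finite_dimension (L_sub R) (carrier R)" using fd by simp
qed

text \<open>A maximal subring of \<open>L(E)\<close> misses some subfield of degree \<open>q\<^sup>a\<close> with \<open>q\<close> unbounded. It is then
  contained in the larger proper subring of \<open>L(E)\<close> avoiding degree \<open>q\<^sup>a\<^sup>+\<^sup>1\<close>, which has the
  subfield of degree \<open>q\<^sup>a\<close>.\<close>

lemma L_sub_no_maximal_subring: "\<not> maximal_subring S (R\<lparr>carrier := L_sub R\<rparr>)"
proof
  let ?L = "L_sub R"
  assume "maximal_subring S (R\<lparr>carrier := ?L\<rparr>)"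
  then have S: "subring S R" "S \<subset> ?L"
    and mx: "\<And>T. subring T R \<Longrightarrow> S \<subseteq> T \<Longrightarrow> T \<subseteq> ?L \<Longrightarrow> T = S \<or> T = ?L"
    unfolding maximal_subring_update_iff[OF L_sub_subring] by blast+
  obtain x where x: "x \<in> ?L" "x \<notin> S" using S(2) by blast
  then obtain n where n: "n \<in> degrees" "x \<in> fixed_field n" "fixed_field n \<subseteq> ?L"
    using mem_subring_iff[OF L_sub_subring] by blast
  then have "\<not> fixed_field n \<subseteq> S" using x by blast
  then obtain q a where q: "Factorial_Ring.prime q" "q ^ a dvd n" "\<not> fixed_field (q ^ a) \<subseteq> S"
    using fixed_field_subset_if_prime_powers[OF S(1) n(1)] by blast
  have d: "q ^ a \<in> degrees" using degrees_dvd_closed[OF n(1) q(2)] prime_gt_0_nat[OF q(1)] by simp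
  have a: "a \<noteq> 0"
  proof
    assume "a = 0"
    then have "q ^ a = 1" by simp
    moreover obtain m where m: "m \<in> degrees" "fixed_field m \<subseteq> S"
      using mem_subring_iff[OF S(1), of \<one>] subringE(3)[OF S(1)] by blast
    ultimately show False using q(3) fixed_field_mono[of 1 m] by auto
  qed
  have "q dvd n" using q(2) a dvd_trans[OF dvd_power[of a q]] by blast
  then have unb: "q ^ b \<in> degrees" for b
    using fixed_field_subset_L_sub_iff[OF n(1)] n(3) q(1) unfolding unbounded_degrees_def by blast
  let ?W = "avoiding_subring (q ^ Suc a)"
  have W: "subring ?W R" by (rule avoiding_subring_subring[OF q(1)]) simp
  have "\<not> fixed_field (q ^ Suc a) \<subseteq> S"
    using fixed_field_mono[OF le_imp_power_dvd, of a "Suc a" q] q(3) by auto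
  then have "S \<subseteq> ?L \<inter> ?W" using subset_avoiding_subring[OF S(1)] S(2) by blast
  then have "?L \<inter> ?W = S \<or> ?L \<inter> ?W = ?L"
    using mx[OF subring_inter[OF L_sub_subring W]] by blast
  moreover have "\<not> ?L \<subseteq> ?W"
    using fixed_field_not_subset_avoiding[OF q(1) _ unb, of "Suc a"]
      unbounded_prime_power_subset_L_sub[OF q(1) unb, of "Suc a"] by blast
  moreover have "\<not> q ^ Suc a dvd q ^ a"
    using power_dvd_imp_le[of q "Suc a" a] prime_gt_1_nat[OF q(1)] by auto
  then have "fixed_field (q ^ a) \<subseteq> ?L \<inter> ?W"
    using fixed_field_subset_avoiding[OF d] unbounded_prime_power_subset_L_sub[OF q(1) unb] by blast
  ultimately show False using q(3) by blast
qed

text \<open>If \<open>F\<close> has no maximal subrings, every prime degree occurring in \<open>F\<close> does so with all its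
  powers, whence \<open>F \<subseteq> L(E)\<close>. Conversely the powers of an unbounded prime cannot all divide the
  degree \<open>N\<close> attached to a basis of \<open>E\<close> over \<open>F\<close>, so \<open>F\<close> contains all the corresponding subfields.\<close>

lemma no_maximal_subring_imp_eq_L_sub:
  assumes F: "subfield F R" and fd: "finite_dimension F (carrier R)"
    and nomax: "\<nexists>S. maximal_subring S (R\<lparr>carrier := F\<rparr>)"
  shows "F = L_sub R"
proof
  have sF: "subring F R" by (rule subfieldE(1)[OF F])
  have all: "q ^ b \<in> degrees" if q: "Factorial_Ring.prime q" "q \<in> degrees" "fixed_field q \<subseteq> F" for q b
  proof (rule ccontr)
    assume b: "q ^ b \<notin> degrees"
    define A where "A = {c. q ^ c \<in> degrees \<and> fixed_field (q ^ c) \<subseteq> F}"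
    have "c < b" if "c \<in> A" for c
    proof (rule ccontr)
      assume "\<not> c < b"
      then have "q ^ b dvd q ^ c" by (simp add: le_imp_power_dvd)
      then show False
        using degrees_dvd_closed[of "q ^ c" "q ^ b"] that b prime_gt_0_nat[OF q(1)] unfolding A_def by simp
    qed
    then have finA: "finite A" using finite_nat_set_iff_bounded by blast
    have oneA: "1 \<in> A" unfolding A_def using q by simp
    have "Max A \<in> A" using Max_in[OF finA] oneA by blast
    moreover have "1 \<le> Max A" by (rule Max_ge[OF finA oneA])
    moreover have "c \<le> Max A" if "q ^ c \<in> degrees" "fixed_field (q ^ c) \<subseteq> F" for c
      using Max_ge[OF finA] that unfolding A_def by blast
    ultimately have "maximal_subring (F \<inter> avoiding_subring (q ^ Max A)) (R\<lparr>carrier := F\<rparr>)"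
      unfolding A_def by (intro maximal_subring_avoiding[OF sF q(1)]) auto
    then show False using nomax by blast
  qed
  show "F \<subseteq> L_sub R"
  proof
    fix x assume "x \<in> F"
    then obtain n where n: "n \<in> degrees" "x \<in> fixed_field n" "fixed_field n \<subseteq> F"
      using mem_subring_iff[OF sF] by blast
    have "q ^ b \<in> degrees" if "Factorial_Ring.prime q" "q dvd n" for q b
      using all[OF that(1)] degrees_dvd_closed[OF n(1) that(2)] prime_gt_0_nat[OF that(1)]
        fixed_field_mono[OF that(2)] n(3) by blast
    then have "n \<in> unbounded_degrees" using n(1) unfolding unbounded_degrees_def by blast
    then show "x \<in> L_sub R" unfolding L_sub_eq using n(2) by blast
  qed
  obtain N where N: "0 < N" "\<forall>q a. Factorial_Ring.prime q \<longrightarrow> 0 < a \<longrightarrow> q ^ a \<in> degrees \<longrightarrow>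
      fixed_field (q ^ a) \<subseteq> F \<or> q ^ a dvd N"
    using finite_dimension_prime_powers[OF F fd] by (elim exE conjE) (rule that)
  show "L_sub R \<subseteq> F"
  proof
    fix x assume "x \<in> L_sub R"
    then obtain n where n: "n \<in> unbounded_degrees" "x \<in> fixed_field n" unfolding L_sub_eq by blast
    then have nd: "n \<in> degrees" unfolding unbounded_degrees_def by blast
    have "fixed_field n \<subseteq> F"
    proof (rule fixed_field_subset_if_prime_powers[OF sF nd])
      fix q a assume q: "Factorial_Ring.prime q" "q ^ a dvd n"
      show "fixed_field (q ^ a) \<subseteq> F"
      proof (cases "a = 0")
        case True
        obtain m where m: "m \<in> degrees" "fixed_field m \<subseteq> F"
          using mem_subring_iff[OF sF, of \<one>] subringE(3)[OF sF] by blast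
        then show ?thesis using True fixed_field_mono[of 1 m] by simp
      next
        case False
        then have "q dvd n" using q(2) dvd_trans[OF dvd_power[of a q]] by blast
        then have unb: "q ^ b \<in> degrees" for b using n(1) q(1) unfolding unbounded_degrees_def by blast
        \<comment> \<open>\<open>q\<^sup>N\<close> exceeds \<open>N\<close>, so \<open>q\<^sup>a\<^sup>+\<^sup>N\<close> is a multiple of \<open>q\<^sup>a\<close> that does not divide \<open>N\<close>\<close>
        let ?b = "a + N"
        have "N < 2 ^ N" by (rule less_exp)
        also have "\<dots> \<le> q ^ N" using prime_ge_2_nat[OF q(1)] by (rule power_mono) simp
        also have "\<dots> \<le> q ^ ?b" using prime_gt_0_nat[OF q(1)] by (intro power_increasing) auto
        finally have "\<not> q ^ ?b dvd N" using N(1) by (auto dest: dvd_imp_le)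
        then have "fixed_field (q ^ ?b) \<subseteq> F" using N(2)[rule_format, OF q(1) _ unb, of ?b] N(1) by auto
        moreover have "fixed_field (q ^ a) \<subseteq> fixed_field (q ^ ?b)"
          by (intro fixed_field_mono le_imp_power_dvd) simp
        ultimately show ?thesis by blast
      qed
    qed
    then show "x \<in> F" using n(2) by blast
  qed
qed

lemma absolutely_algebraic: "absolutely_algebraic R"
proof -
  have "GF_sub R p 1 prime_subring"
    unfolding GF_sub_def using prime_subfield finite_prime_subring card_prime_subring by simp
  then show ?thesis
    unfolding absolutely_algebraic_def using field_axioms prime_p algebraic by blast
qed

end

text \<open>The \<open>p\<close>-element subfield of the definition has additive order \<open>p\<close>, so that \<open>p\<close> kills \<open>1\<close> and the
  subfield is the prime field.\<close>

lemma (in field) absolutely_algebraic_imp_locale: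
  assumes "absolutely_algebraic R"
  obtains p where "absolutely_algebraic_field R p"
proof -
  obtain p K where p: "Factorial_Ring.prime p" "GF_sub R p 1 K"
    and alg: "\<And>x. x \<in> carrier R \<Longrightarrow> (algebraic over K) x"
    using assms unfolding absolutely_algebraic_def by blast
  have K: "subfield K R" "finite K" "card K = p" using p(2) unfolding GF_sub_def by auto
  note E = subringE[OF subfieldE(1)[OF K(1)]]
  interpret A: group "(add_monoid R)\<lparr>carrier := K\<rparr>"
    using subgroup.subgroup_is_group[OF subring.axioms(1)[OF subfieldE(1)[OF K(1)]] add.is_group] .
  have "\<one> [^]\<^bsub>(add_monoid R)\<lparr>carrier := K\<rparr>\<^esub> p = \<zero>"
    using A.pow_order_eq_1[of \<one>] E(3) K unfolding order_def by simp
  moreover have "x [^]\<^bsub>(add_monoid R)\<lparr>carrier := K\<rparr>\<^esub> n = [n] \<cdot> x" for n :: nat and x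
    by (simp add: nat_pow_def add_pow_def)
  ultimately have char: "[(int p)] \<cdot> \<one> = \<zero>" by (simp add: add_pow_int_ge)
  then interpret prime_char_field R p
    using p(1) by unfold_locales
  have "K = prime_subring" by (rule card_p_subfield_eq[OF K])
  then have "absolutely_algebraic_field R p" using alg by unfold_locales simp
  then show thesis by (rule that)
qed

lemma (in field) finite_maximal_subrings_imp_locale:
  assumes "finite {S. maximal_subring S R}"
  obtains p where "absolutely_algebraic_field R p"
proof -
  obtain p :: nat where p: "Factorial_Ring.prime p" "[(int p)] \<cdot> \<one> = \<zero>"
    "\<And>x. x \<in> carrier R \<Longrightarrow> (algebraic over prime_subring) x"
    using finite_maximal_subrings_imp_algebraic[OF assms] by blast
  then have "absolutely_algebraic_field R p" by unfold_locales
  then show thesis by (rule that)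
qed

text \<open>A field without maximal subrings has finitely many, so \<open>F\<close> is absolutely algebraic; and \<open>R\<close> is
  algebraic over \<open>F\<close>.\<close>

lemma (in field) no_maximal_subring_imp_locale:
  assumes F: "subfield F R" and fd: "finite_dimension F (carrier R)"
    and nomax: "\<nexists>S. maximal_subring S (R\<lparr>carrier := F\<rparr>)"
  obtains p where "absolutely_algebraic_field R p"
proof -
  have sF: "subring F R" by (rule subfieldE(1)[OF F])
  interpret RF: field "R\<lparr>carrier := F\<rparr>" by (rule subfield_iff(2)[OF F])
  have emp: "{S. maximal_subring S (R\<lparr>carrier := F\<rparr>)} = {}" using nomax by blast
  obtain p where "absolutely_algebraic_field (R\<lparr>carrier := F\<rparr>) p"
    using RF.finite_maximal_subrings_imp_locale unfolding emp by blast
  then interpret A: absolutely_algebraic_field "R\<lparr>carrier := F\<rparr>" p .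
  have pow: "add_pow (R\<lparr>carrier := F\<rparr>) k \<one> = [k] \<cdot> \<one>" for k :: int
    using add.int_pow_consistent[OF subring.axioms(1)[OF sF] subringE(3)[OF sF], of k]
    by (simp add: add_pow_def)
  have P: "RF.prime_subring = prime_subring"
    unfolding RF.prime_subring_def prime_subring_def using pow by simp
  interpret prime_char_field R p
    using A.prime_p A.char_p pow by unfold_locales simp_all
  have algF: "(algebraic over prime_subring) x" if "x \<in> F" for x
    using A.algebraic[of x] that algebraic_consistent[OF sF] P by simp
  have "(algebraic over prime_subring) x" if x: "x \<in> carrier R" for x
    using algebraic_trans[OF prime_subfield sF algF x]
      finite_dimension_imp_algebraic[OF F carrier_is_subring fd x] by blast
  then have "absolutely_algebraic_field R p" by unfold_locales
  then show thesis by (rule that)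
qed

section \<open>The equivalence\<close>

theorem theorem2p2:
  fixes E :: "('a, 'b) ring_scheme"
  assumes "field E"
  shows "let cond1 = finite {S. maximal_subring S E};
             cond2 = absolutely_algebraic E \<and> ring.finite_dimension E (L_sub E) (carrier E);
             cond3 = (\<lambda>F. subfield F E \<and> (\<nexists>S. maximal_subring S (E\<lparr>carrier := F\<rparr>)) \<and>
                           ring.finite_dimension E F (carrier E))
         in (cond1 \<longleftrightarrow> cond2) \<and> (cond2 \<longleftrightarrow> (\<exists>F. cond3 F)) \<and>
            (cond1 \<or> cond2 \<or> (\<exists>F. cond3 F) \<longrightarrow> (\<forall>F. cond3 F \<longleftrightarrow> F = L_sub E))"
proof -
  interpret field E by fact
  let ?c1 = "finite {S. maximal_subring S E}"
  let ?c2 = "absolutely_algebraic E \<and> finite_dimension (L_sub E) (carrier E)"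
  let ?c3 = "\<lambda>F. subfield F E \<and> (\<nexists>S. maximal_subring S (E\<lparr>carrier := F\<rparr>)) \<and>
    finite_dimension F (carrier E)"
  have c12: "?c2" if c: "?c1"
  proof -
    obtain p where "absolutely_algebraic_field E p"
      using finite_maximal_subrings_imp_locale[OF c] by blast
    then interpret absolutely_algebraic_field E p .
    show ?thesis
      using absolutely_algebraic finite_dimension_L_sub_iff finite_maximal_subrings_iff c by blast
  qed
  have c2: "?c1 \<and> ?c3 (L_sub E)" if c: "?c2"
  proof -
    obtain p where "absolutely_algebraic_field E p"
      using absolutely_algebraic_imp_locale c by blast
    then interpret absolutely_algebraic_field E p .
    show ?thesis
      using L_sub_subfield L_sub_no_maximal_subring finite_dimension_L_sub_iff
        finite_maximal_subrings_iff c by blast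
  qed
  have c3: "F = L_sub E \<and> ?c2" if c: "?c3 F" for F
  proof -
    obtain p where "absolutely_algebraic_field E p"
      using no_maximal_subring_imp_locale[of F] c by blast
    then interpret absolutely_algebraic_field E p .
    have "F = L_sub E" using no_maximal_subring_imp_eq_L_sub[of F] c by blast
    then show ?thesis using absolutely_algebraic c by blast
  qed
  have "(?c1 \<longleftrightarrow> ?c2) \<and> (?c2 \<longleftrightarrow> (\<exists>F. ?c3 F)) \<and>
      (?c1 \<or> ?c2 \<or> (\<exists>F. ?c3 F) \<longrightarrow> (\<forall>F. ?c3 F \<longleftrightarrow> F = L_sub E))"
    using c12 c2 c3 by blast
  then show ?thesis unfolding Let_def .
qed

end
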